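(* Let $q\ge 4$ and let $P_1,P_2$ be two distinct points of the line $\mathrm{PG}(V)$. Then $\mathcal Y\cup\{P_1,P_2\}$ is a $4$-general set of $\Pi\cong\mathrm{PG}(5,q)$ of size $q^2-q+2$.
   Context: $q$ is a prime power. Regard $\mathbb F_{q^6}$ as a $6$-dimensional $\mathbb F_q$-vector space and let $\Pi=\mathrm{PG}(\mathbb F_{q^6})\cong\mathrm{PG}(5,q)$, whose points are $\langle x\rangle=\mathbb F_q^*x$, $x\ne0$. Let $\mathcal Y=\{\langle b-1\rangle : b\in\mathbb F_{q^6},\ b^{q^2-q+1}=1,\ b\ne 1\}$. Let $F(X)=X^{q^2}-X^q+X$ (an $\mathbb F_q$-linear map of $\mathbb F_{q^6}$) and $V=\ker F$, a $2$-dimensional $\mathbb F_q$-subspace, so $\mathrm{PG}(V)$ is a line of $\Pi$. For integers $r,s$, an $(r,s)$-set of $\mathrm{PG}(n,q)$ is a set $\mathcal X$ of points such that: (i) every $s$-dimensional projective subspace contains at most $r$ points of $\mathcal X$; (ii) $\mathcal X$ spans $\mathrm{PG}(n,q)$; (iii) some $(s+1)$-dimensional projective subspace contains $r+2$ points of $\mathcal X$. A $4$-general set is a $(3,2)$-set. *)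

theory Defs
  imports "HOL-Computational_Algebra.Primes"
begin

text \<open>The ambient field F_{q^6} is a finite field type 'a of cardinality q^6;
  the subfield F_q is the set of elements fixed by x \<mapsto> x^q.\<close>

definition Fq :: "nat \<Rightarrow> 'a::field set" where
  "Fq q = {c. c ^ q = c}"

definition prime_power :: "nat \<Rightarrow> bool" where
  "prime_power q \<longleftrightarrow> (\<exists>p k. prime p \<and> k > 0 \<and> q = p ^ k)"

definition Fq_span :: "nat \<Rightarrow> 'a::field set \<Rightarrow> 'a set" where
  "Fq_span q S = {(\<Sum>x\<in>T. f x * x) | T f. finite T \<and> T \<subseteq> S \<and> (\<forall>x\<in>T. f x \<in> Fq q)}"

definition Fq_indep :: "nat \<Rightarrow> 'a::field set \<Rightarrow> bool" where
  "Fq_indep q S \<longleftrightarrow> (\<forall>T f. finite T \<and> T \<subseteq> S \<and> (\<forall>x\<in>T. f x \<in> Fq q) \<and> (\<Sum>x\<in>T. f x * x) = 0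
      \<longrightarrow> (\<forall>x\<in>T. f x = 0))"

definition pt :: "nat \<Rightarrow> 'a::field \<Rightarrow> 'a set" where
  "pt q x = {c * x | c. c \<in> Fq q \<and> c \<noteq> 0}"

definition is_point :: "nat \<Rightarrow> 'a::field set \<Rightarrow> bool" where
  "is_point q P \<longleftrightarrow> (\<exists>x. x \<noteq> 0 \<and> P = pt q x)"

definition PG :: "nat \<Rightarrow> 'a::field set \<Rightarrow> 'a set set" where
  "PG q W = {pt q x | x. x \<in> W \<and> x \<noteq> 0}"

definition proj_subspace :: "nat \<Rightarrow> nat \<Rightarrow> 'a::field set set \<Rightarrow> bool" where
  "proj_subspace q s S \<longleftrightarrow>
     (\<exists>B. finite B \<and> card B = s + 1 \<and> Fq_indep q B \<and> S = PG q (Fq_span q B))"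

definition rs_set :: "nat \<Rightarrow> nat \<Rightarrow> nat \<Rightarrow> 'a::field set set \<Rightarrow> bool" where
  "rs_set q r s X \<longleftrightarrow>
     (\<forall>P\<in>X. is_point q P) \<and>
     (\<forall>S. proj_subspace q s S \<longrightarrow> card (S \<inter> X) \<le> r) \<and>
     Fq_span q (\<Union>X) = UNIV \<and>
     (\<exists>S. proj_subspace q (s + 1) S \<and> card (S \<inter> X) = r + 2)"

definition four_general :: "nat \<Rightarrow> 'a::field set set \<Rightarrow> bool" where
  "four_general q X \<longleftrightarrow> rs_set q 3 2 X"

definition Yset :: "nat \<Rightarrow> 'a::field set set" where
  "Yset q = {pt q (b - 1) | b. b ^ (q\<^sup>2 - q + 1) = 1 \<and> b \<noteq> 1}"

definition Vker :: "nat \<Rightarrow> 'a::field set" where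
  "Vker q = {x. x ^ (q\<^sup>2) - x ^ q + x = 0}"

end

theory Submission
  imports Defs "HOL-Computational_Algebra.Polynomial" "HOL-Library.FuncSet"
begin

text \<open>If \<open>b ^ (q\<^sup>2 - q + 1) = 1\<close>, then with \<open>x = b\<close> and \<open>y = b ^ q\<close> the conjugates of \<open>b\<close> are
  \<open>x, y, y/x, 1/x, 1/y, x/y\<close>. A linear relation over the subfield among the points \<open>b - 1\<close> is therefore a
  system of weights on points \<open>(x, y)\<close> that annihilates these six functions and the constants, hence all
  products of a form in \<open>1, x, y\<close> with a form in \<open>1, 1/x, 1/y\<close>; elements of \<open>V\<close> contribute a derivative at
  \<open>(1, 1)\<close>. No three of the points \<open>(x, y)\<close> are collinear, so for at most five points one finds a product
  vanishing at all of them but one, and the weights are zero: any four points are independent.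

  The points span because the set \<open>mu\<close> of all such \<open>b\<close> is too large to be an arc in a plane of order \<open>q\<close>. A pigeonhole argument
  on the elements \<open>b - 1/b\<close> gives four points of \<open>mu\<close> whose span contains \<open>P1\<close>. It contains no further
  point, since otherwise the weights, paired with products of a form in \<open>1, x, 1/y, x/y\<close> and a form in
  \<open>1, y/x\<close>, place four points of \<open>mu\<close> on a curve of bidegree (1,1), and such a curve contains at most three.\<close>

section \<open>Finite fields\<close>

text \<open>Multiplication by a nonzero \<open>x\<close> permutes the nonzero elements, so their
  product is unchanged when every factor is multiplied by \<open>x\<close>.\<close>

lemma finite_field_power_card:
  fixes x :: "'a::{field, finite}"
  shows "x ^ card (UNIV :: 'a set) = x"
proof (cases "x = 0")
  case False
  have "x * (\<Prod>y\<in>UNIV-{0}. x * y) = x ^ Suc (card (UNIV :: 'a set) - 1) * \<Prod>(UNIV-{0})"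
    by (simp add: prod.distrib mult_ac)
  also have "Suc (card (UNIV :: 'a set) - 1) = card (UNIV :: 'a set)"
    using finite_UNIV_card_ge_0[where ?'a = 'a] by simp
  also have "(\<Prod>y\<in>UNIV-{0}. x * y) = (\<Prod>y\<in>UNIV-{0}. y)"
    by (rule prod.reindex_bij_witness[of _ "\<lambda>y. y / x" "\<lambda>y. x * y"]) (use False in auto)
  finally show ?thesis
    by simp
qed (use finite_UNIV_card_ge_0[where ?'a = 'a] in auto)

text \<open>All roots of \<open>X ^ (n * m) - 1 = (X ^ n - 1) * (\<Sum>i<m. X ^ (n * i))\<close> lie in the field, so the
  first factor, whose cofactor has at most \<open>n * m - n\<close> roots, has at least \<open>n\<close> of them.\<close>

lemma card_roots_of_unity_finite_field:
  fixes n :: nat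
  assumes "n dvd card (UNIV :: 'a::{field, finite} set) - 1"
  shows "card {x::'a. x ^ n = 1} = n"
proof -
  let ?N = "card (UNIV :: 'a set)"
  have N: "?N > 1"
  proof -
    have "card {0, 1::'a} \<le> ?N" by (intro card_mono) auto
    then show ?thesis by simp
  qed
  obtain m where m: "?N - 1 = n * m" using assms by (auto simp: dvd_def)
  have nm: "n > 0" "m > 0" using N m by (auto intro: gr0I)
  define p where "p = monom (1::'a) n - 1"
  define r where "r = (\<Sum>i<m. monom (1::'a) (n * i))"
  have p_deg: "degree p = n" and p0: "p \<noteq> 0"
  proof -
    have "coeff p n = 1" using nm by (simp add: p_def)
    moreover have "degree p \<le> n" unfolding p_def
      by (intro degree_diff_le degree_monom_le) simp
    ultimately show "degree p = n" "p \<noteq> 0"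
      using le_degree[of p n] by auto
  qed
  have r_deg: "degree r \<le> n * (m - 1)" unfolding r_def
    by (intro degree_sum_le order_trans[OF degree_monom_le]) auto
  have "coeff r 0 = (\<Sum>i<m. if i = 0 then 1 else 0)"
    unfolding r_def coeff_sum using nm by (intro sum.cong) auto
  then have r0: "r \<noteq> 0" using nm by auto
  have "UNIV - {0} \<subseteq> {x::'a. poly p x = 0} \<union> {x. poly r x = 0}"
  proof
    fix x :: 'a assume "x \<in> UNIV - {0}"
    moreover have "x * x ^ (?N - 1) = x"
      using finite_field_power_card[of x] N by (simp flip: power_Suc)
    ultimately have "x ^ (n * m) = 1" using m by simp
    moreover have "poly p x * poly r x = x ^ (n * m) - 1"
      using power_diff_1_eq[of "x ^ n" m]
      by (simp add: p_def r_def poly_monom poly_sum power_mult)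
    ultimately show "x \<in> {x. poly p x = 0} \<union> {x. poly r x = 0}" by auto
  qed
  then have "card (UNIV - {0::'a}) \<le> card ({x. poly p x = 0} \<union> {x. poly r x = 0})"
    by (intro card_mono) auto
  also have "\<dots> \<le> card {x. poly p x = 0} + card {x. poly r x = 0}" by (rule card_Un_le)
  finally have "n * m \<le> card {x. poly p x = 0} + n * (m - 1)"
    using m card_poly_roots_bound[OF r0] r_deg by (simp add: card_Diff_singleton)
  then have "n \<le> card {x. poly p x = 0}"
    using nm by (cases m) auto
  with card_poly_roots_bound[OF p0] p_deg have "card {x. poly p x = 0} = n" by simp
  then show ?thesis by (simp add: p_def poly_monom)
qed

section \<open>The field of order \<open>q ^ 6\<close> and its Frobenius map\<close>

locale sextic_field =
  fixes q :: nat and ty :: "'a::{field, finite} itself"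
  assumes prime_power_q: "prime_power q" and q_ge: "q \<ge> 4"
    and card_UNIV: "card (UNIV :: 'a set) = q ^ 6"
begin

text \<open>The sum of all elements is invariant under translation by 1, so the field order is zero
  in the field; hence the characteristic is the prime of which \<open>q\<close> is a power, and the
  freshman's dream applies.\<close>

lemma frobenius_add: "(x + y :: 'a) ^ (q ^ n) = x ^ (q ^ n) + y ^ (q ^ n)"
proof -
  obtain p k where pk: "prime p" "k > 0" "q = p ^ k"
    using prime_power_q by (auto simp: prime_power_def)
  have pr: "prime CHAR('a)"
    using prime_CHAR_semidom[where ?'a='a] finite_imp_CHAR_pos[where ?'a='a] by simp
  have "(\<Sum>x\<in>UNIV. x + 1) = (\<Sum>x\<in>UNIV. x :: 'a)"
    by (rule sum.reindex_bij_witness[of _ "\<lambda>x. x - 1" "\<lambda>x. x + 1"]) auto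
  then have "of_nat (card (UNIV :: 'a set)) = (0 :: 'a)"
    by (simp add: sum.distrib)
  then have "CHAR('a) dvd p ^ (k * 6)"
    using card_UNIV pk by (simp only: of_nat_eq_0_iff_char_dvd power_mult)
  then have "CHAR('a) = p"
    using pr pk(1) by (meson prime_dvd_power primes_dvd_imp_eq)
  then have "q ^ n = CHAR('a) ^ (k * n)" using pk by (simp add: power_mult)
  then show ?thesis using freshmans_dream'[OF pr] by blast
qed

lemma frobenius_minus: "(- x :: 'a) ^ (q ^ n) = - (x ^ (q ^ n))"
  using frobenius_add[of "-x" x n] q_ge by (simp add: eq_neg_iff_add_eq_0 power_0_left)

lemma frobenius_diff: "(x - y :: 'a) ^ (q ^ n) = x ^ (q ^ n) - y ^ (q ^ n)"
  using frobenius_add[of x "-y" n] by (simp add: frobenius_minus)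

lemma frobenius_sum: "(\<Sum>i\<in>T. f i :: 'a) ^ (q ^ n) = (\<Sum>i\<in>T. f i ^ (q ^ n))"
  using q_ge by (induction T rule: infinite_finite_induct) (auto simp: frobenius_add)

lemmas frobenius_add1 = frobenius_add[of _ _ 1, simplified]
  and frobenius_minus1 = frobenius_minus[of _ 1, simplified]
  and frobenius_diff1 = frobenius_diff[of _ _ 1, simplified]
  and frobenius_sum1 = frobenius_sum[of _ _ 1, simplified]

lemma frobenius_Suc: "(x::'a) ^ (q ^ Suc n) = (x ^ (q ^ n)) ^ q"
  by (simp add: mult.commute flip: power_mult)

lemma frobenius_commute: "((x::'a) ^ q) ^ m = (x ^ m) ^ q"
  by (simp add: mult.commute flip: power_mult)

lemma frobenius_2: "(x::'a) ^ q\<^sup>2 = (x ^ q) ^ q"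
  by (simp add: power2_eq_square power_mult)

lemma frobenius_3: "(x::'a) ^ (q ^ 3) = (x ^ q\<^sup>2) ^ q"
  using frobenius_Suc[of x 2] by simp

lemma frobenius_inject: "x ^ (q ^ n) = (y::'a) ^ (q ^ n) \<longleftrightarrow> x = y"
  using frobenius_diff[of x y n] by auto

lemma frobenius_inject1: "x ^ q = (y::'a) ^ q \<longleftrightarrow> x = y"
  using frobenius_inject[of x 1 y] by simp

section \<open>The subfield of order \<open>q\<close>\<close>

abbreviation K :: "'a set" where "K \<equiv> Fq q"

lemma K_iff: "c \<in> K \<longleftrightarrow> c ^ q = c"
  by (simp add: Fq_def)

lemma K_0 [simp]: "0 \<in> K" and K_1 [simp]: "1 \<in> K"
  using q_ge by (auto simp: Fq_def)

lemma K_add [simp]: "c \<in> K \<Longrightarrow> d \<in> K \<Longrightarrow> c + d \<in> K"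
  and K_minus [simp]: "c \<in> K \<Longrightarrow> - c \<in> K"
  and K_diff [simp]: "c \<in> K \<Longrightarrow> d \<in> K \<Longrightarrow> c - d \<in> K"
  and K_mult [simp]: "c \<in> K \<Longrightarrow> d \<in> K \<Longrightarrow> c * d \<in> K"
  and K_divide [simp]: "c \<in> K \<Longrightarrow> d \<in> K \<Longrightarrow> c / d \<in> K"
  by (auto simp: Fq_def frobenius_add1 frobenius_diff1 frobenius_minus1 power_mult_distrib power_divide)

lemma K_sum [simp]: "(\<And>i. i \<in> T \<Longrightarrow> f i \<in> K) \<Longrightarrow> sum f T \<in> K"
  by (induction T rule: infinite_finite_induct) auto

lemma K_power: "c \<in> K \<Longrightarrow> c ^ (q ^ n) = c"
  by (induction n) (auto simp: K_iff frobenius_Suc simp del: power_Suc)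

lemma dvd_card_minus_1: "q - 1 dvd q ^ 6 - 1" "q\<^sup>2 - q + 1 dvd q ^ 6 - 1"
proof -
  \<comment> \<open>The factorisations are carried out over the integers, where subtraction is not
    truncated.\<close>
  have "int q ^ 6 - 1 = (int q - 1) * (int q ^ 5 + int q ^ 4 + int q ^ 3 + int q ^ 2 + int q + 1)"
    "int q ^ 6 - 1 = ((int q)\<^sup>2 - int q + 1) * ((int q ^ 3 - 1) * (int q + 1))"
    by algebra+
  then have "int q - 1 dvd int q ^ 6 - 1" "(int q)\<^sup>2 - int q + 1 dvd int q ^ 6 - 1"
    by (metis dvd_triv_left)+
  moreover have "q \<le> q\<^sup>2" "1 \<le> q ^ 6" "1 \<le> q"
    using q_ge by (auto simp: power2_eq_square)
  ultimately have "int (q - 1) dvd int (q ^ 6 - 1)" "int (q\<^sup>2 - q + 1) dvd int (q ^ 6 - 1)"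
    by (auto simp: of_nat_diff algebra_simps)
  then show "q - 1 dvd q ^ 6 - 1" "q\<^sup>2 - q + 1 dvd q ^ 6 - 1"
    by (simp_all only: of_nat_dvd_iff)
qed

lemma card_K: "card K = q"
proof -
  have "(c::'a) ^ q = c * c ^ (q - 1)" for c
    using q_ge by (simp flip: power_Suc)
  then have "(c::'a) ^ q = c \<longleftrightarrow> c = 0 \<or> c ^ (q - 1) = 1" for c
    by auto
  then have "K = insert 0 {c. c ^ (q - 1) = 1}"
    by (auto simp: Fq_def)
  moreover have "0 \<notin> {c::'a. c ^ (q - 1) = 1}" using q_ge by (simp add: power_0_left)
  ultimately have "card K = Suc (card {c::'a. c ^ (q - 1) = 1})"
    by simp
  also have "card {c::'a. c ^ (q - 1) = 1} = q - 1"
    using dvd_card_minus_1(1) card_UNIV by (intro card_roots_of_unity_finite_field) simp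
  finally show ?thesis using q_ge by simp
qed

text \<open>The subgroup of order \<open>q\<^sup>2 - q + 1\<close>. It keeps 1, which yields no
  point but serves as the base point at which weights are balanced.\<close>

definition mu :: "'a set" where
  "mu = {b. b ^ (q\<^sup>2 - q + 1) = 1}"

lemma card_mu: "card mu = q\<^sup>2 - q + 1"
  unfolding mu_def using dvd_card_minus_1(2) card_UNIV
  by (intro card_roots_of_unity_finite_field) simp

lemma one_in_mu [simp]: "1 \<in> mu" by (simp add: mu_def)

lemma mu_nonzero: "b \<in> mu \<Longrightarrow> b \<noteq> 0" by (auto simp: mu_def simp del: power_Suc)

lemma inverse_in_mu [simp]: "b \<in> mu \<Longrightarrow> inverse b \<in> mu"
  unfolding mu_def by (simp only: mem_Collect_eq power_inverse inverse_1)

lemma divide_in_mu: "b \<in> mu \<Longrightarrow> c \<in> mu \<Longrightarrow> b / c \<in> mu"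
  by (simp add: mu_def power_divide)

lemma mu_frobenius_2: assumes "b \<in> mu" shows "b ^ q\<^sup>2 = b ^ q / b"
proof -
  have "q \<le> q\<^sup>2" using q_ge by (auto simp: power2_eq_square)
  then have "b ^ q\<^sup>2 * b = b ^ (q\<^sup>2 - q + 1) * b ^ q"
    by (simp flip: power_add power_Suc2)
  then show ?thesis using assms mu_nonzero[OF assms] by (simp add: mu_def field_simps)
qed

lemma mu_frobenius_3: assumes "b \<in> mu" shows "b ^ (q ^ 3) = 1 / b"
proof -
  have "b ^ (q ^ 3) = (b ^ q / b) ^ q"
    by (simp only: frobenius_3 mu_frobenius_2[OF assms])
  also have "\<dots> = b ^ q\<^sup>2 / b ^ q"
    by (simp only: power_divide frobenius_2)
  also have "\<dots> = 1 / b"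
    using mu_nonzero[OF assms] by (simp add: mu_frobenius_2[OF assms])
  finally show ?thesis .
qed

text \<open>A fixed \<open>b\<close> satisfies
  \<open>b = b ^ q\<^sup>2 = b ^ q / b = 1\<close>.\<close>

lemma mu_K: assumes "b \<in> mu" "b ^ q = b" shows "b = 1"
  using mu_frobenius_2[OF assms(1)] mu_nonzero[OF assms(1)] assms(2)
  by (simp add: frobenius_2)

text \<open>The group has odd order. Concretely, \<open>b ^ q\<close> is \<open>b\<close> or
  \<open>- b\<close>; the second case forces \<open>b = -1\<close>, which the Frobenius map fixes as
  well.\<close>

lemma mu_square: assumes "b \<in> mu" "b * b = 1" shows "b = 1"
proof -
  have "b ^ q * b ^ q = 1" using assms(2) by (simp flip: power_mult_distrib)
  then have "(b ^ q = b \<or> b ^ q = - b)" using assms(2) by (metis square_eq_iff)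
  moreover have "b = -1" if "b ^ q = - b"
    using mu_frobenius_2[OF assms(1)] mu_nonzero[OF assms(1)] that
    by (simp add: frobenius_2 frobenius_minus1)
  moreover have "(-1::'a) ^ q = -1" using frobenius_minus1[of 1] by simp
  ultimately show ?thesis using mu_K[OF assms(1)] by metis
qed

section \<open>Lines and curves of bidegree (1,1) through roots of unity\<close>

lemma poly_eq_0_if_many_roots:
  fixes p :: "'a poly"
  assumes "\<And>x. x \<in> S \<Longrightarrow> poly p x = 0" and "degree p < card S"
  shows "p = 0"
proof (rule ccontr)
  assume "p \<noteq> 0"
  have "card S \<le> card {x. poly p x = 0}" using assms(1) by (intro card_mono) auto
  with card_poly_roots_bound[OF \<open>p \<noteq> 0\<close>] assms(2) show False by simp
qed

text \<open>The quotient \<open>b / c\<close> is fixed by the Frobenius map. Geometrically, a line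
  through the origin contains at most one point \<open>(b, b ^ q)\<close>.\<close>

lemma mu_frobenius_eq_scaled:
  assumes "b \<in> mu" "c \<in> mu" "b ^ q * c = c ^ q * b"
  shows "b = c"
proof -
  have "(b / c) ^ q = b / c"
    using assms mu_nonzero[OF assms(1)] mu_nonzero[OF assms(2)]
    by (simp add: power_divide field_simps)
  then have "b / c = 1" using mu_K divide_in_mu assms by blast
  then show ?thesis using mu_nonzero[OF assms(2)] by simp
qed

text \<open>Raising to the power \<open>q ^ 3\<close> shows that the points \<open>(1/b, 1/b ^ q)\<close> are collinear as well, so
  the line is met by the conic which is its image under the standard Cremona involution.\<close>

lemma mu_not_collinear:
  assumes S: "S \<subseteq> mu" "card S = 3"
    and line: "\<And>b. b \<in> S \<Longrightarrow> \<alpha> + \<beta> * b + \<gamma> * b ^ q = 0"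
  shows "\<alpha> = 0 \<and> \<beta> = 0 \<and> \<gamma> = 0"
proof -
  define A B C where "A = \<alpha> ^ (q ^ 3)" and "B = \<beta> ^ (q ^ 3)" and "C = \<gamma> ^ (q ^ 3)"
  have conic: "A * b * b ^ q + B * b ^ q + C * b = 0" if "b \<in> S" for b
  proof -
    have b: "b \<in> mu" "b \<noteq> 0" using that S mu_nonzero by auto
    have bq: "(b ^ q) ^ (q ^ 3) = 1 / b ^ q"
      by (simp only: frobenius_commute[of b] mu_frobenius_3[OF b(1)] power_divide power_one)
    have "(\<alpha> + \<beta> * b + \<gamma> * b ^ q) ^ (q ^ 3) = 0" using line[OF that] q_ge by simp
    then have "A + B * (1 / b) + C * (1 / b ^ q) = 0"
      by (simp only: frobenius_add power_mult_distrib bq mu_frobenius_3[OF b(1)] A_def B_def C_def)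
    then show ?thesis using b(2) by (simp add: field_simps)
  qed
  obtain b1 b2 where b12: "b1 \<in> S" "b2 \<in> S" "b1 \<noteq> b2"
    using S(2) by (auto simp: card_3_iff)
  show ?thesis
  proof (cases "\<gamma> = 0")
    case True
    then have "\<beta> * (b1 - b2) = (\<alpha> + \<beta> * b1 + \<gamma> * b1 ^ q) - (\<alpha> + \<beta> * b2 + \<gamma> * b2 ^ q)"
      by (simp add: algebra_simps)
    then have "\<beta> = 0" using b12(3) line[OF b12(1)] line[OF b12(2)] by simp
    then show ?thesis using True line[OF b12(1)] by simp
  next
    case False
    \<comment> \<open>Eliminating \<open>b ^ q\<close> between line and conic leaves this quadratic
      in \<open>b\<close>. Its three roots make it zero, and its outer coefficients then give
      \<alpha> = 0 or \<beta> = 0.\<close>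
    define p where "p = [:- (B * \<alpha>), C * \<gamma> - A * \<alpha> - B * \<beta>, - (A * \<beta>):]"
    have "poly p b = 0" if "b \<in> S" for b
    proof -
      have "poly p b = \<gamma> * (A * b * b ^ q + B * b ^ q + C * b)
          - (A * b + B) * (\<alpha> + \<beta> * b + \<gamma> * b ^ q)"
        by (simp add: p_def algebra_simps)
      then show ?thesis using line[OF that] conic[OF that] by simp
    qed
    moreover have "degree p < card S"
      unfolding p_def using S by (simp add: less_Suc_eq_le)
    ultimately have "p = 0" by (rule poly_eq_0_if_many_roots)
    then have "\<alpha> = 0 \<or> \<beta> = 0" by (auto simp: p_def A_def B_def)
    then show ?thesis
    proof
      assume a: "\<alpha> = 0"
      have "\<gamma> * (b1 ^ q * b2 - b2 ^ q * b1) = b2 * (\<alpha> + \<beta> * b1 + \<gamma> * b1 ^ q) - b1 * (\<alpha> + \<beta> * b2 + \<gamma> * b2 ^ q)"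
        by (simp add: a algebra_simps)
      then have "b1 ^ q * b2 = b2 ^ q * b1" using line[OF b12(1)] line[OF b12(2)] False by simp
      then have "b1 = b2" using b12 S mu_frobenius_eq_scaled by blast
      then show ?thesis using b12 by simp
    next
      assume b: "\<beta> = 0"
      have "\<gamma> * (b1 ^ q - b2 ^ q) = (\<alpha> + \<beta> * b1 + \<gamma> * b1 ^ q) - (\<alpha> + \<beta> * b2 + \<gamma> * b2 ^ q)"
        by (simp add: b algebra_simps)
      then have "b1 ^ q = b2 ^ q" using line[OF b12(1)] line[OF b12(2)] False by simp
      then show ?thesis using b12 frobenius_inject1 by simp
    qed
  qed
qed

text \<open>Inversion preserves \<open>mu\<close> and turns a dual line into a line.\<close>

lemma mu_not_dual_collinear:
  assumes S: "S \<subseteq> mu" "card S = 3"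
    and line: "\<And>b. b \<in> S \<Longrightarrow> \<alpha> + \<beta> / b + \<gamma> / b ^ q = 0"
  shows "\<alpha> = 0 \<and> \<beta> = 0 \<and> \<gamma> = 0"
proof (rule mu_not_collinear)
  show "inverse ` S \<subseteq> mu" using S by auto
  show "card (inverse ` S) = 3" using S by (simp add: card_image inj_on_def)
  show "\<alpha> + \<beta> * b + \<gamma> * b ^ q = 0" if "b \<in> inverse ` S" for b
    using that line by (auto simp: power_inverse divide_inverse)
qed

text \<open>Raising to the power \<open>q\<close> gives a second such relation, between \<open>b ^ q\<close> and \<open>b ^ q / b\<close>. An
  irreducible curve of bidegree (1,1) meets its conjugate in at most three points.\<close>

lemma mu_not_on_bilinear_curve:
  assumes S: "S \<subseteq> mu" "card S = 4"
    and curve: "\<And>b. b \<in> S \<Longrightarrow> \<alpha> * b * b ^ q + \<beta> * b + \<gamma> * b ^ q + \<delta> = 0"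
  shows "\<alpha> = 0 \<and> \<beta> = 0 \<and> \<gamma> = 0 \<and> \<delta> = 0"
proof -
  have conj: "\<alpha> ^ q * (b ^ q)\<^sup>2 + \<beta> ^ q * b * b ^ q + \<gamma> ^ q * b ^ q + \<delta> ^ q * b = 0" if "b \<in> S" for b
  proof -
    have b: "b \<in> mu" "b \<noteq> 0" using that S mu_nonzero by auto
    have "(\<alpha> * b * b ^ q + \<beta> * b + \<gamma> * b ^ q + \<delta>) ^ q = 0" using curve[OF that] q_ge by simp
    then have "\<alpha> ^ q * b ^ q * (b ^ q / b) + \<beta> ^ q * b ^ q + \<gamma> ^ q * (b ^ q / b) + \<delta> ^ q = 0"
      by (simp only: frobenius_add1 power_mult_distrib mu_frobenius_2[OF b(1)] flip: frobenius_2)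
    then show ?thesis using b(2) by (simp add: field_simps power2_eq_square)
  qed
  have "\<alpha> = 0"
  proof (rule ccontr)
    assume \<alpha>: "\<alpha> \<noteq> 0"
    \<comment> \<open>A degenerate curve is the union of a vertical and a horizontal line, each with
      at most one point \<open>(b, b ^ q)\<close>.\<close>
    have det: "\<alpha> * \<delta> \<noteq> \<beta> * \<gamma>"
    proof
      assume "\<alpha> * \<delta> = \<beta> * \<gamma>"
      have "b = - \<gamma> / \<alpha> \<or> b ^ q = - \<beta> / \<alpha>" if "b \<in> S" for b
      proof -
        have "(\<alpha> * b + \<gamma>) * (\<alpha> * b ^ q + \<beta>) = \<alpha> * (\<alpha> * b * b ^ q + \<beta> * b + \<gamma> * b ^ q + \<delta>)"
          using \<open>\<alpha> * \<delta> = \<beta> * \<gamma>\<close> by (simp add: algebra_simps)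
        then have "\<alpha> * b + \<gamma> = 0 \<or> \<alpha> * b ^ q + \<beta> = 0" using curve[OF that] by simp
        then show ?thesis using \<alpha> by (auto simp: field_simps eq_neg_iff_add_eq_0)
      qed
      then have "S \<subseteq> {- \<gamma> / \<alpha>} \<union> {b. b ^ q = - \<beta> / \<alpha>}" by blast
      then have "card S \<le> card ({- \<gamma> / \<alpha>} \<union> {b. b ^ q = - \<beta> / \<alpha>})"
        by (intro card_mono) auto
      also have "\<dots> \<le> card {- \<gamma> / \<alpha>} + card {b. b ^ q = - \<beta> / \<alpha>}" by (rule card_Un_le)
      also have "card {b::'a. b ^ q = - \<beta> / \<alpha>} \<le> 1"
        unfolding One_nat_def by (subst card_le_Suc0_iff_eq) (simp, metis frobenius_inject1 mem_Collect_eq)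
      finally show False using S(2) by simp
    qed
    \<comment> \<open>The curve gives \<open>b ^ q\<close> as a fractional linear function of
      \<open>b\<close>; inserting it into \<open>conj\<close> and clearing denominators yields this
      cubic, which has four roots.\<close>
    define p where "p = smult (\<alpha> ^ q) ([:\<delta>, \<beta>:] * [:\<delta>, \<beta>:])
      - smult (\<beta> ^ q) ([:0, 1:] * [:\<delta>, \<beta>:] * [:\<gamma>, \<alpha>:]) - smult (\<gamma> ^ q) ([:\<delta>, \<beta>:] * [:\<gamma>, \<alpha>:])
      + smult (\<delta> ^ q) ([:0, 1:] * [:\<gamma>, \<alpha>:] * [:\<gamma>, \<alpha>:])"
    have poly_p: "poly p x = \<alpha> ^ q * (\<beta> * x + \<delta>) * (\<beta> * x + \<delta>) - \<beta> ^ q * x * (\<beta> * x + \<delta>) * (\<alpha> * x + \<gamma>)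
        - \<gamma> ^ q * (\<beta> * x + \<delta>) * (\<alpha> * x + \<gamma>) + \<delta> ^ q * x * (\<alpha> * x + \<gamma>) * (\<alpha> * x + \<gamma>)" for x
      by (simp add: p_def algebra_simps)
    have "poly p b = 0" if "b \<in> S" for b
    proof -
      let ?m = "\<alpha> * b + \<gamma>" and ?n = "\<beta> * b + \<delta>"
      have n: "?n = - (b ^ q * ?m)"
        using curve[OF that] by (simp add: algebra_simps eq_neg_iff_add_eq_0)
      have "poly p b = ?m * ?m * (\<alpha> ^ q * (b ^ q)\<^sup>2 + \<beta> ^ q * b * b ^ q + \<gamma> ^ q * b ^ q + \<delta> ^ q * b)"
        unfolding poly_p n by (simp add: algebra_simps power2_eq_square)
      then show ?thesis using conj[OF that] by simp
    qed
    moreover have "degree p < card S"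
      unfolding p_def S(2)
      by (simp add: less_Suc_eq_le numeral_eq_Suc degree_diff_le degree_add_le)
    ultimately have p0: "p = 0" by (rule poly_eq_0_if_many_roots)
    have "coeff p 3 = \<alpha> * (\<delta> ^ q * \<alpha> - \<beta> ^ q * \<beta>)"
      by (simp add: p_def numeral_eq_Suc algebra_simps)
    then have c3: "\<delta> ^ q * \<alpha> = \<beta> ^ q * \<beta>" using p0 \<alpha> by simp
    have "\<beta> \<noteq> 0" using c3 \<alpha> det by auto
    \<comment> \<open>At the root of \<open>\<beta> * x + \<delta>\<close> only the last summand of
      the cubic survives, and \<open>det\<close> keeps its factor
      \<open>\<alpha> * x + \<gamma>\<close> away from zero.\<close>
    define x where "x = - \<delta> / \<beta>"
    have x: "\<beta> * x = - \<delta>" using \<open>\<beta> \<noteq> 0\<close> by (simp add: x_def)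
    have "\<alpha> * x + \<gamma> \<noteq> 0"
    proof
      assume "\<alpha> * x + \<gamma> = 0"
      then have "\<alpha> * (\<beta> * x) + \<beta> * \<gamma> = 0"
        by (metis distrib_left mult.left_commute mult_zero_right)
      then show False using det x by simp
    qed
    moreover have "\<delta> ^ q * x * (\<alpha> * x + \<gamma>) * (\<alpha> * x + \<gamma>) = 0"
      using poly_p[of x] p0 x by simp
    ultimately have "\<delta> = 0 \<or> x = 0" by auto
    then have "\<delta> = 0" using x by auto
    then show False using c3 \<open>\<beta> \<noteq> 0\<close> q_ge by (simp add: power_0_left)
  qed
  moreover obtain T where T: "T \<subseteq> S" "card T = 3"
    using obtain_subset_with_card_n[of 3 S] S by auto
  ultimately have "\<delta> = 0 \<and> \<beta> = 0 \<and> \<gamma> = 0"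
    using S(1) curve by (intro mu_not_collinear[of T]) (auto simp: algebra_simps)
  then show ?thesis using \<open>\<alpha> = 0\<close> by simp
qed

section \<open>The space \<open>V\<close> and its position relative to \<open>mu\<close>\<close>

abbreviation V :: "'a set" where "V \<equiv> Vker q"

lemma V_iff: "v \<in> V \<longleftrightarrow> v ^ q\<^sup>2 = v ^ q - v"
proof -
  have "v ^ q\<^sup>2 - v ^ q + v = v ^ q\<^sup>2 - (v ^ q - v)" by simp
  then show ?thesis unfolding Vker_def by (simp only: mem_Collect_eq eq_iff_diff_eq_0[of "v ^ q\<^sup>2"])
qed

lemma V_frobenius_2: "v \<in> V \<Longrightarrow> v ^ q\<^sup>2 = v ^ q - v"
  by (simp add: V_iff)

lemma V_0 [simp]: "0 \<in> V"
  using q_ge by (simp add: Vker_def power_0_left)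

lemma V_add [simp]: "v \<in> V \<Longrightarrow> w \<in> V \<Longrightarrow> v + w \<in> V"
  by (simp add: V_iff frobenius_add frobenius_add1)

lemma V_scale [simp]: "c \<in> K \<Longrightarrow> v \<in> V \<Longrightarrow> c * v \<in> V"
  using K_power[of c 2]
  by (simp add: V_iff K_iff power_mult_distrib right_diff_distrib)

lemma V_minus [simp]: "v \<in> V \<Longrightarrow> - v \<in> V"
  using V_scale[of "-1" v] by simp

lemma V_diff [simp]: "v \<in> V \<Longrightarrow> w \<in> V \<Longrightarrow> v - w \<in> V"
  using V_add[of v "-w"] by simp

text \<open>The map with kernel \<open>V\<close> sends \<open>b - 1\<close> to
  \<open>(1 - b) * (b ^ q - b) / b\<close>, which vanishes on \<open>mu\<close> only at 1.\<close>

lemma mu_notin_V: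
  assumes "b \<in> mu" "b \<noteq> 1"
  shows "b - 1 \<notin> V"
proof
  assume "b - 1 \<in> V"
  then have "b ^ q / b - b ^ q + b - 1 = 0"
    by (simp add: Vker_def frobenius_diff frobenius_diff1 mu_frobenius_2[OF assms(1)] algebra_simps)
  then have "(1 - b) * (b ^ q - b) = 0"
    using mu_nonzero[OF assms(1)] by (simp add: field_simps)
  then show False using assms mu_K by auto
qed

text \<open>Equality would make \<open>(b - 1) / v\<close> an element of the subfield and so put
  \<open>b - 1\<close> into \<open>V\<close>. Geometrically, the line through \<open>(1, 1)\<close>
  in direction \<open>(v, v ^ q)\<close> meets no other point of \<open>mu\<close>.\<close>

lemma mu_not_tangent:
  assumes "b \<in> mu" "b \<noteq> 1" "v \<in> V" "v \<noteq> 0"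
  shows "(b - 1) * v ^ q \<noteq> (b - 1) ^ q * v"
proof
  assume "(b - 1) * v ^ q = (b - 1) ^ q * v"
  then have "((b - 1) / v) ^ q = (b - 1) / v"
    using assms(4) by (simp add: power_divide field_simps)
  then have "(b - 1) / v * v \<in> V" using assms(3) by (intro V_scale) (simp_all add: K_iff)
  then show False using mu_notin_V assms by simp
qed

section \<open>Linear relations\<close>

text \<open>Each equation is the Frobenius image of the one before. The weights are fixed, and the
  elements of \<open>V\<close> run through \<open>v, v ^ q, v ^ q - v\<close> and their
  negatives.\<close>

lemma relation_conjugates:
  assumes T: "T \<subseteq> mu" and f: "\<And>b. b \<in> T \<Longrightarrow> f b \<in> K" and v: "v \<in> V"
    and rel: "(\<Sum>b\<in>T. f b * b) = v"
  shows "(\<Sum>b\<in>T. f b * b ^ q) = v ^ q"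
    and "(\<Sum>b\<in>T. f b * (b ^ q / b)) = v ^ q - v"
    and "(\<Sum>b\<in>T. f b * (1 / b)) = - v"
    and "(\<Sum>b\<in>T. f b * (1 / b ^ q)) = - (v ^ q)"
    and "(\<Sum>b\<in>T. f b * (b / b ^ q)) = v - v ^ q"
proof -
  have conj: "(\<Sum>b\<in>T. f b * h b ^ q) = w ^ q" if "(\<Sum>b\<in>T. f b * h b) = w" for h :: "'a \<Rightarrow> 'a" and w
  proof -
    have "(\<Sum>b\<in>T. f b * h b ^ q) = (\<Sum>b\<in>T. (f b * h b) ^ q)"
      using f by (intro sum.cong) (auto simp: power_mult_distrib K_iff)
    then show ?thesis using that by (simp add: frobenius_sum1[symmetric])
  qed
  show 1: "(\<Sum>b\<in>T. f b * b ^ q) = v ^ q" using conj[OF rel] .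
  have "(\<Sum>b\<in>T. f b * (b ^ q / b)) = (\<Sum>b\<in>T. f b * (b ^ q) ^ q)"
    using T by (intro sum.cong) (auto simp: mu_frobenius_2 simp flip: frobenius_2)
  then show 2: "(\<Sum>b\<in>T. f b * (b ^ q / b)) = v ^ q - v"
    using conj[OF 1] V_frobenius_2[OF v] by (simp add: frobenius_2)
  have "(\<Sum>b\<in>T. f b * (1 / b)) = (\<Sum>b\<in>T. f b * (b ^ q / b) ^ q)"
    using T by (intro sum.cong) (auto simp: mu_frobenius_2[symmetric] frobenius_3[symmetric] mu_frobenius_3)
  then show 3: "(\<Sum>b\<in>T. f b * (1 / b)) = - v"
    using conj[OF 2] V_frobenius_2[OF v] by (simp add: frobenius_2 frobenius_diff1)
  show 4: "(\<Sum>b\<in>T. f b * (1 / b ^ q)) = - (v ^ q)"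
    using conj[OF 3] by (simp add: power_divide frobenius_minus1)
  have "(\<Sum>b\<in>T. f b * (b / b ^ q)) = (\<Sum>b\<in>T. f b * (1 / b ^ q) ^ q)"
    using T by (intro sum.cong) (auto simp: power_divide frobenius_2[symmetric] mu_frobenius_2)
  then show "(\<Sum>b\<in>T. f b * (b / b ^ q)) = v - v ^ q"
    using conj[OF 4] V_frobenius_2[OF v] by (simp add: frobenius_2 frobenius_minus1)
qed

text \<open>The nine products of \<open>1, b, b ^ q\<close> with \<open>1, 1/b, 1/b ^ q\<close> are \<open>1\<close> and the six conjugates of \<open>b\<close>.
  The right-hand side is the derivative of the product at \<open>b = 1\<close> in the direction
  \<open>(v, v ^ q)\<close>, so elements of \<open>V\<close> act as tangent vectors.\<close>

lemma relation_product_forms: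
  assumes T: "T \<subseteq> mu" and f: "\<And>b. b \<in> T \<Longrightarrow> f b \<in> K" and v: "v \<in> V"
    and rel0: "(\<Sum>b\<in>T. f b) = 0" and rel: "(\<Sum>b\<in>T. f b * b) = v"
  shows "(\<Sum>b\<in>T. f b * ((\<alpha> + \<beta> * b + \<gamma> * b ^ q) * (\<alpha>' + \<beta>' / b + \<gamma>' / b ^ q)))
    = (\<beta> * v + \<gamma> * v ^ q) * (\<alpha>' + \<beta>' + \<gamma>') - (\<alpha> + \<beta> + \<gamma>) * (\<beta>' * v + \<gamma>' * v ^ q)"
proof -
  have "(\<Sum>b\<in>T. f b * ((\<alpha> + \<beta> * b + \<gamma> * b ^ q) * (\<alpha>' + \<beta>' / b + \<gamma>' / b ^ q)))
    = (\<Sum>b\<in>T. (\<alpha> * \<alpha>' + \<beta> * \<beta>' + \<gamma> * \<gamma>') * f b + \<beta> * \<alpha>' * (f b * b) + \<gamma> * \<alpha>' * (f b * b ^ q)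
        + \<gamma> * \<beta>' * (f b * (b ^ q / b)) + \<alpha> * \<beta>' * (f b * (1 / b)) + \<alpha> * \<gamma>' * (f b * (1 / b ^ q))
        + \<beta> * \<gamma>' * (f b * (b / b ^ q)))"
  proof (intro sum.cong refl)
    fix b assume "b \<in> T"
    then have b: "b \<noteq> 0" "b ^ q \<noteq> 0" using T mu_nonzero by auto
    have "(\<alpha> + \<beta> * b + \<gamma> * y) * (\<alpha>' + \<beta>' / b + \<gamma>' / y) = (\<alpha> * \<alpha>' + \<beta> * \<beta>' + \<gamma> * \<gamma>') + \<beta> * \<alpha>' * b
        + \<gamma> * \<alpha>' * y + \<gamma> * \<beta>' * (y / b) + \<alpha> * \<beta>' * (1 / b) + \<alpha> * \<gamma>' * (1 / y) + \<beta> * \<gamma>' * (b / y)"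
      if "y \<noteq> 0" for y
      using b(1) that by (simp add: field_simps)
    from this[OF b(2)] show "f b * ((\<alpha> + \<beta> * b + \<gamma> * b ^ q) * (\<alpha>' + \<beta>' / b + \<gamma>' / b ^ q)) =
        (\<alpha> * \<alpha>' + \<beta> * \<beta>' + \<gamma> * \<gamma>') * f b + \<beta> * \<alpha>' * (f b * b) + \<gamma> * \<alpha>' * (f b * b ^ q)
        + \<gamma> * \<beta>' * (f b * (b ^ q / b)) + \<alpha> * \<beta>' * (f b * (1 / b)) + \<alpha> * \<gamma>' * (f b * (1 / b ^ q))
        + \<beta> * \<gamma>' * (f b * (b / b ^ q))"
      by (simp only: distrib_left mult_ac)
  qed
  also have "\<dots> = \<beta> * \<alpha>' * v + \<gamma> * \<alpha>' * v ^ q + \<gamma> * \<beta>' * (v ^ q - v) + \<alpha> * \<beta>' * (- v)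
      + \<alpha> * \<gamma>' * (- (v ^ q)) + \<beta> * \<gamma>' * (v - v ^ q)"
    by (simp only: sum.distrib sum_distrib_left[symmetric] rel0 rel relation_conjugates[OF T f v rel]) simp
  also have "\<dots> = (\<beta> * v + \<gamma> * v ^ q) * (\<alpha>' + \<beta>' + \<gamma>') - (\<alpha> + \<beta> + \<gamma>) * (\<beta>' * v + \<gamma>' * v ^ q)"
    by (simp add: algebra_simps)
  finally show ?thesis .
qed

text \<open>These products also involve only 1 and the six conjugates of \<open>b\<close>, and the
  right-hand side is again the derivative at \<open>(1, 1)\<close> in direction
  \<open>(v, v ^ q)\<close>.\<close>

lemma relation_product_bilinear_forms:
  assumes T: "T \<subseteq> mu" and f: "\<And>b. b \<in> T \<Longrightarrow> f b \<in> K" and v: "v \<in> V"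
    and rel0: "(\<Sum>b\<in>T. f b) = 0" and rel: "(\<Sum>b\<in>T. f b * b) = v"
  shows "(\<Sum>b\<in>T. f b * ((\<alpha> + \<beta> * b + \<gamma> / b ^ q + \<delta> * b / b ^ q) * (b ^ q / b - \<zeta>)))
    = (\<alpha> + \<beta> + \<gamma> + \<delta>) * (v ^ q - v) + (\<beta> * v - \<gamma> * v ^ q + \<delta> * (v - v ^ q)) * (1 - \<zeta>)"
proof -
  have "(\<Sum>b\<in>T. f b * ((\<alpha> + \<beta> * b + \<gamma> / b ^ q + \<delta> * b / b ^ q) * (b ^ q / b - \<zeta>)))
    = (\<Sum>b\<in>T. (\<delta> - \<zeta> * \<alpha>) * f b + (- \<zeta> * \<beta>) * (f b * b) + \<beta> * (f b * b ^ q)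
        + \<alpha> * (f b * (b ^ q / b)) + \<gamma> * (f b * (1 / b)) + (- \<zeta> * \<gamma>) * (f b * (1 / b ^ q))
        + (- \<zeta> * \<delta>) * (f b * (b / b ^ q)))"
  proof (intro sum.cong refl)
    fix b assume "b \<in> T"
    then have b: "b \<noteq> 0" "b ^ q \<noteq> 0" using T mu_nonzero by auto
    have "(\<alpha> + \<beta> * b + \<gamma> / y + \<delta> * b / y) * (y / b - \<zeta>) = (\<delta> - \<zeta> * \<alpha>) + (- \<zeta> * \<beta>) * b + \<beta> * y
        + \<alpha> * (y / b) + \<gamma> * (1 / b) + (- \<zeta> * \<gamma>) * (1 / y) + (- \<zeta> * \<delta>) * (b / y)"
      if "y \<noteq> 0" for y
      using b(1) that by (simp add: field_simps)
    from this[OF b(2)] show "f b * ((\<alpha> + \<beta> * b + \<gamma> / b ^ q + \<delta> * b / b ^ q) * (b ^ q / b - \<zeta>)) =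
        (\<delta> - \<zeta> * \<alpha>) * f b + (- \<zeta> * \<beta>) * (f b * b) + \<beta> * (f b * b ^ q)
        + \<alpha> * (f b * (b ^ q / b)) + \<gamma> * (f b * (1 / b)) + (- \<zeta> * \<gamma>) * (f b * (1 / b ^ q))
        + (- \<zeta> * \<delta>) * (f b * (b / b ^ q))"
      by (simp only: distrib_left mult_ac)
  qed
  also have "\<dots> = (- \<zeta> * \<beta>) * v + \<beta> * v ^ q + \<alpha> * (v ^ q - v) + \<gamma> * (- v)
      + (- \<zeta> * \<gamma>) * (- (v ^ q)) + (- \<zeta> * \<delta>) * (v - v ^ q)"
    by (simp only: sum.distrib sum_distrib_left[symmetric] rel0 rel relation_conjugates[OF T f v rel]) simp
  also have "\<dots> = (\<alpha> + \<beta> + \<gamma> + \<delta>) * (v ^ q - v) + (\<beta> * v - \<gamma> * v ^ q + \<delta> * (v - v ^ q)) * (1 - \<zeta>)"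
    by (simp add: algebra_simps)
  finally show ?thesis .
qed

text \<open>Smaller sets are filled up so that later arguments can name an exact number of points to
  be avoided by \<open>b\<close>.\<close>

lemma mu_pad:
  assumes "T \<subseteq> mu" "b \<notin> T" "b \<in> mu" "card T \<le> n" "n \<le> q\<^sup>2 - q"
  obtains T' where "T \<subseteq> T'" "T' \<subseteq> mu" "b \<notin> T'" "card T' = n"
proof -
  have "n \<le> card (mu - {b})" using assms card_mu by simp
  then have "\<exists>B. T \<subseteq> B \<and> B \<subseteq> mu - {b} \<and> card B = n"
    using assms by (intro exists_subset_between) auto
  then show ?thesis using that by blast
qed

lemma q_square_ge: "4 * q \<le> q\<^sup>2"
  using q_ge by (simp add: power2_eq_square)

text \<open>The coefficients are the cross product of \<open>(1, b1, b1 ^ q)\<close> and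
  \<open>(1, b2, b2 ^ q)\<close>; the last one being nonzero ensures a nontrivial form.\<close>

lemma exists_line_through:
  assumes "b1 \<noteq> b2"
  obtains \<alpha> \<beta> \<gamma> :: 'a where "\<gamma> \<noteq> 0" "\<alpha> + \<beta> * b1 + \<gamma> * b1 ^ q = 0" "\<alpha> + \<beta> * b2 + \<gamma> * b2 ^ q = 0"
proof -
  show ?thesis
  proof (rule that)
    show "b2 - b1 \<noteq> 0" using assms by simp
  next
    show "(b1 * b2 ^ q - b2 * b1 ^ q) + (b1 ^ q - b2 ^ q) * b1 + (b2 - b1) * b1 ^ q = 0"
      "(b1 * b2 ^ q - b2 * b1 ^ q) + (b1 ^ q - b2 ^ q) * b2 + (b2 - b1) * b2 ^ q = 0"
      by (simp_all add: algebra_simps)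
  qed
qed

lemma exists_dual_line_through:
  assumes "b1 \<noteq> b2"
  obtains \<alpha> \<beta> \<gamma> :: 'a where "\<gamma> \<noteq> 0" "\<alpha> + \<beta> / b1 + \<gamma> / b1 ^ q = 0" "\<alpha> + \<beta> / b2 + \<gamma> / b2 ^ q = 0"
proof -
  have "inverse b1 \<noteq> inverse b2" using assms by simp
  from exists_line_through[OF this] that show ?thesis
    by (metis divide_inverse power_inverse)
qed

text \<open>Among five points, a line through two of them and a dual line through another two give a
  product of forms that vanishes at all but the fifth.\<close>

lemma mu_affine_independent:
  assumes T: "T \<subseteq> mu" "card T \<le> 5" and f: "\<And>b. b \<in> T \<Longrightarrow> f b \<in> K"
    and rel0: "(\<Sum>b\<in>T. f b) = 0" and rel: "(\<Sum>b\<in>T. f b * b) = 0" and b: "b \<in> T"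
  shows "f b = 0"
proof -
  have "card (T - {b}) \<le> 4" using T b by simp
  moreover have "(4::nat) \<le> q\<^sup>2 - q" using q_square_ge q_ge by linarith
  ultimately obtain T' where T': "T - {b} \<subseteq> T'" "T' \<subseteq> mu" "b \<notin> T'" "card T' = 4"
    using mu_pad[of "T - {b}" b 4] T b by auto
  then obtain b2 b3 b4 b5 where T'_eq: "T' = {b2, b3, b4, b5}" and d: "distinct [b2, b3, b4, b5]"
    by (auto simp: card_Suc_eq numeral_eq_Suc)
  have mu: "b \<in> mu" "b2 \<in> mu" "b3 \<in> mu" "b4 \<in> mu" "b5 \<in> mu" using T' T'_eq T b by auto
  have d': "b2 \<noteq> b3" "b4 \<noteq> b5" using d by auto
  have nb: "b \<noteq> b2" "b \<noteq> b3" "b \<noteq> b4" "b \<noteq> b5" using T' T'_eq by auto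
  obtain \<alpha> \<beta> \<gamma> where l: "\<gamma> \<noteq> 0" "\<alpha> + \<beta> * b2 + \<gamma> * b2 ^ q = 0" "\<alpha> + \<beta> * b3 + \<gamma> * b3 ^ q = 0"
    using exists_line_through[OF d'(1)] by blast
  obtain \<alpha>' \<beta>' \<gamma>' where l': "\<gamma>' \<noteq> 0" "\<alpha>' + \<beta>' / b4 + \<gamma>' / b4 ^ q = 0" "\<alpha>' + \<beta>' / b5 + \<gamma>' / b5 ^ q = 0"
    using exists_dual_line_through[OF d'(2)] by blast
  have n: "\<alpha> + \<beta> * b + \<gamma> * b ^ q \<noteq> 0"
    using mu_not_collinear[of "{b, b2, b3}" \<alpha> \<beta> \<gamma>] mu nb d l by auto
  have n': "\<alpha>' + \<beta>' / b + \<gamma>' / b ^ q \<noteq> 0"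
    using mu_not_dual_collinear[of "{b, b4, b5}" \<alpha>' \<beta>' \<gamma>'] mu nb d l' by auto
  let ?g = "\<lambda>b. (\<alpha> + \<beta> * b + \<gamma> * b ^ q) * (\<alpha>' + \<beta>' / b + \<gamma>' / b ^ q)"
  have "?g c = 0" if "c \<in> T - {b}" for c
  proof -
    have "c = b2 \<or> c = b3 \<or> c = b4 \<or> c = b5" using that T'(1) T'_eq by auto
    then show ?thesis using l l' by (elim disjE) simp_all
  qed
  then have "(\<Sum>c\<in>T. f c * ?g c) = (\<Sum>c\<in>{b}. f c * ?g c)"
    using b by (intro sum.mono_neutral_right) auto
  moreover have "(\<Sum>c\<in>T. f c * ?g c) = 0"
    using relation_product_forms[OF T(1) f _ rel0 rel, of \<alpha> \<beta> \<gamma> \<alpha>' \<beta>' \<gamma>'] q_ge by simp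
  ultimately show ?thesis using n n' by simp
qed

text \<open>The base point 1 receives minus the total weight, which balances the relation; no weight
  is overwritten because 1 is not in \<open>T\<close>.\<close>

lemma relation_from_difference_relation:
  assumes T: "T \<subseteq> mu - {1}" and f: "\<And>b. b \<in> T \<Longrightarrow> f b \<in> K"
    and rel: "(\<Sum>b\<in>T. f b * (b - 1)) = v"
  defines "f1 \<equiv> f(1 := - (\<Sum>b\<in>T. f b))"
  shows "insert 1 T \<subseteq> mu" "\<And>b. b \<in> insert 1 T \<Longrightarrow> f1 b \<in> K"
    "(\<Sum>b\<in>insert 1 T. f1 b) = 0" "(\<Sum>b\<in>insert 1 T. f1 b * b) = v"
proof -
  have n: "1 \<notin> T" "finite T" using T by auto
  show "insert 1 T \<subseteq> mu" using T by auto
  show "f1 b \<in> K" if "b \<in> insert 1 T" for b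
    using that f by (auto simp: f1_def)
  have eq: "f1 b = f b" if "b \<in> T" for b using that n by (auto simp: f1_def)
  have "(\<Sum>b\<in>T. f1 b) = (\<Sum>b\<in>T. f b)" "(\<Sum>b\<in>T. f1 b * b) = (\<Sum>b\<in>T. f b * b)"
    using eq by (auto intro!: sum.cong)
  then show "(\<Sum>b\<in>insert 1 T. f1 b) = 0" "(\<Sum>b\<in>insert 1 T. f1 b * b) = v"
    using n rel by (simp_all add: f1_def algebra_simps sum_subtractf)
qed

text \<open>Together with the base point 1 there are at most five points.\<close>

lemma mu_independent:
  assumes T: "T \<subseteq> mu - {1}" "card T \<le> 4" and f: "\<And>b. b \<in> T \<Longrightarrow> f b \<in> K"
    and rel: "(\<Sum>b\<in>T. f b * (b - 1)) = 0" and b: "b \<in> T"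
  shows "f b = 0"
proof -
  note rels = relation_from_difference_relation[OF T(1) f rel]
  have "card (insert 1 T) \<le> 5" using T by (simp add: card_insert_if)
  from mu_affine_independent[OF rels(1) this rels(2-4), of b]
  have "(f(1 := - (\<Sum>b\<in>T. f b))) b = 0" using b by simp
  then show ?thesis using b T by (auto split: if_splits)
qed

text \<open>A line through two points is paired with the dual line that is tangent at 1 in the
  direction of \<open>v\<close>. Their product vanishes at 1 together with its derivative along
  \<open>v\<close>, so the contribution of \<open>v\<close> disappears.\<close>

lemma mu_independent_mod_V:
  assumes T: "T \<subseteq> mu - {1}" "card T \<le> 3" and f: "\<And>b. b \<in> T \<Longrightarrow> f b \<in> K"
    and rel: "(\<Sum>b\<in>T. f b * (b - 1)) \<in> V" and b: "b \<in> T"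
  shows "f b = 0"
proof (cases "(\<Sum>b\<in>T. f b * (b - 1)) = 0")
  case True
  then show ?thesis using mu_independent[of T f b] T f b by simp
next
  case False
  define v where "v = (\<Sum>b\<in>T. f b * (b - 1))"
  have v: "v \<in> V" "v \<noteq> 0" using rel False by (auto simp: v_def)
  define f1 where "f1 = f(1 := - (\<Sum>b\<in>T. f b))"
  note rels = relation_from_difference_relation[OF T(1) f v_def[symmetric], folded f1_def]
  have card: "card (T - {b}) \<le> 2" using T b by simp
  have "(3::nat) \<le> q\<^sup>2 - q" using q_square_ge q_ge by linarith
  moreover have "card (insert 1 (T - {b})) \<le> 3" using card by (simp add: card_insert_if)
  moreover have "insert 1 (T - {b}) \<subseteq> mu" "b \<notin> insert 1 (T - {b})" "b \<in> mu" using T b by auto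
  ultimately obtain T' where T': "insert 1 (T - {b}) \<subseteq> T'" "T' \<subseteq> mu" "b \<notin> T'" "card T' = 3"
    using mu_pad[of "insert 1 (T - {b})" b 3] by blast
  then have "card (T' - {1}) = 2" by auto
  then obtain b2 b3 where T'_eq: "T' - {1} = {b2, b3}" and d: "b2 \<noteq> b3"
    by (auto simp: card_2_iff)
  have mu: "b \<in> mu" "b2 \<in> mu" "b3 \<in> mu" "b \<noteq> 1" "b \<noteq> b2" "b \<noteq> b3" using T' T'_eq T b by auto
  obtain \<alpha> \<beta> \<gamma> where l: "\<gamma> \<noteq> 0" "\<alpha> + \<beta> * b2 + \<gamma> * b2 ^ q = 0" "\<alpha> + \<beta> * b3 + \<gamma> * b3 ^ q = 0"
    using exists_line_through[OF d] by blast
  have n: "\<alpha> + \<beta> * b + \<gamma> * b ^ q \<noteq> 0"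
    using mu_not_collinear[of "{b, b2, b3}" \<alpha> \<beta> \<gamma>] mu d l by auto
  \<comment> \<open>The tangent dual line at 1; by \<open>mu_not_tangent\<close> it misses
    \<open>b\<close>.\<close>
  define \<alpha>' \<beta>' \<gamma>' where "\<alpha>' = v - v ^ q" and "\<beta>' = v ^ q" and "\<gamma>' = - v"
  have tangent: "\<alpha>' + \<beta>' + \<gamma>' = 0" "\<beta>' * v + \<gamma>' * v ^ q = 0"
    by (simp_all add: \<alpha>'_def \<beta>'_def \<gamma>'_def)
  have n': "\<alpha>' + \<beta>' / b + \<gamma>' / b ^ q \<noteq> 0"
  proof
    have ib: "inverse b \<in> mu" "inverse b \<noteq> 1" using mu by auto
    assume "\<alpha>' + \<beta>' / b + \<gamma>' / b ^ q = 0"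
    then have "(inverse b - 1) * v ^ q - (inverse b - 1) ^ q * v = 0"
      by (simp add: \<alpha>'_def \<beta>'_def \<gamma>'_def frobenius_diff1 power_inverse divide_inverse algebra_simps)
    then show False using mu_not_tangent[OF ib v] by simp
  qed
  let ?g = "\<lambda>b. (\<alpha> + \<beta> * b + \<gamma> * b ^ q) * (\<alpha>' + \<beta>' / b + \<gamma>' / b ^ q)"
  have "?g c = 0" if "c \<in> insert 1 T - {b}" for c
  proof -
    have "c = b2 \<or> c = b3 \<or> c = 1" using that T'(1) T'_eq by auto
    then show ?thesis using l tangent by (elim disjE) simp_all
  qed
  then have "(\<Sum>c\<in>insert 1 T. f1 c * ?g c) = (\<Sum>c\<in>{b}. f1 c * ?g c)"
    using b by (intro sum.mono_neutral_right) auto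
  moreover have "(\<Sum>c\<in>insert 1 T. f1 c * ?g c) = 0"
    using relation_product_forms[OF rels(1,2) v(1) rels(3,4), of \<alpha> \<beta> \<gamma> \<alpha>' \<beta>' \<gamma>'] tangent by simp
  ultimately have "f1 b = 0" using n n' by simp
  then show ?thesis using mu by (simp add: f1_def)
qed

text \<open>At most three linear conditions are imposed on four coefficients. By counting, two
  coefficient vectors take the same values on \<open>S\<close>, and their difference is the required
  curve.\<close>

lemma exists_bilinear_curve_through:
  assumes "card S \<le> 3"
  obtains \<alpha> \<beta> \<gamma> \<delta> :: 'a where "\<not> (\<alpha> = 0 \<and> \<beta> = 0 \<and> \<gamma> = 0 \<and> \<delta> = 0)"
    and "\<And>b. b \<in> S \<Longrightarrow> \<alpha> * b * b ^ q + \<beta> * b + \<gamma> * b ^ q + \<delta> = 0"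
proof -
  let ?\<phi> = "\<lambda>(\<alpha>, \<beta>, \<gamma>, \<delta>). \<lambda>b\<in>S. \<alpha> * b * b ^ q + \<beta> * b + \<gamma> * b ^ q + \<delta> :: 'a"
  have "card (range ?\<phi>) \<le> card (S \<rightarrow>\<^sub>E (UNIV :: 'a set))"
    by (intro card_mono finite_PiE) auto
  also have "\<dots> = (q ^ 6) ^ card S" by (simp add: card_PiE card_UNIV)
  also have "\<dots> \<le> (q ^ 6) ^ 3" using assms q_ge by (intro power_increasing) auto
  also have "\<dots> < (q ^ 6) ^ 4" using q_ge by (intro power_strict_increasing one_less_power) auto
  also have "\<dots> = card (UNIV :: ('a \<times> 'a \<times> 'a \<times> 'a) set)"
    by (simp add: card_UNIV card_cartesian_product numeral_eq_Suc flip: UNIV_Times_UNIV)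
  finally have "\<not> inj ?\<phi>" by (rule pigeonhole)
  then obtain u w where uw: "u \<noteq> w" "?\<phi> u = ?\<phi> w" unfolding inj_def by blast
  obtain a b c d where u: "u = (a, b, c, d)" by (cases u)
  obtain a' b' c' d' where w: "w = (a', b', c', d')" by (cases w)
  show ?thesis
  proof (rule that)
    show "\<not> (a - a' = 0 \<and> b - b' = 0 \<and> c - c' = 0 \<and> d - d' = 0)" using uw(1) u w by auto
    show "(a - a') * x * x ^ q + (b - b') * x + (c - c') * x ^ q + (d - d') = 0" if "x \<in> S" for x
    proof -
      have "a * x * x ^ q + b * x + c * x ^ q + d = a' * x * x ^ q + b' * x + c' * x ^ q + d'"
        using fun_cong[OF uw(2), of x] that u w by simp
      then show ?thesis by (simp add: algebra_simps)
    qed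
  qed
qed

text \<open>Pairing both relations with the forms \<open>1, b, 1/b ^ q, b/b ^ q\<close> shows that \<open>(b - c)/(b - 1)\<close> lies in
  a fixed multiple of the subfield for the four \<open>b \<in> T\<close>, which puts them on a curve of bidegree (1,1).\<close>

lemma mu_notin_tangent_span:
  assumes T: "T \<subseteq> mu - {1}" "card T = 4" and c: "c \<in> mu" "c \<noteq> 1" "c \<notin> T"
    and r: "\<And>b. b \<in> T \<Longrightarrow> r b \<in> K" and s: "\<And>b. b \<in> T \<Longrightarrow> s b \<in> K"
    and rel_r: "(\<Sum>b\<in>T. r b * (b - 1)) = v" and rel_s: "(\<Sum>b\<in>T. s b * (b - 1)) = c - 1"
    and v: "v \<in> V"
  shows "v = 0"
proof (rule ccontr)
  assume v0: "v \<noteq> 0"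
  have fin: "finite T" by simp
  define s' where "s' = s(c := - 1)"
  have s'_T: "s' b = s b" if "b \<in> T" for b using that c by (auto simp: s'_def)
  have T': "insert c T \<subseteq> mu - {1}" using T c by auto
  have s'K: "s' b \<in> K" if "b \<in> insert c T" for b using that s by (auto simp: s'_def)
  have "(\<Sum>b\<in>T. s' b * (b - 1)) = (\<Sum>b\<in>T. s b * (b - 1))" using s'_T by (intro sum.cong) auto
  then have rel_s': "(\<Sum>b\<in>insert c T. s' b * (b - 1)) = 0"
    using rel_s c fin by (simp add: s'_def)
  \<comment> \<open>Otherwise the relation would involve only \<open>c\<close> and three points of
    \<open>T\<close>, and its weight -1 at \<open>c\<close> would contradict the independence of
    four points.\<close>
  have s_nz: "s b \<noteq> 0" if b: "b \<in> T" for b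
  proof
    assume "s b = 0"
    have "b \<noteq> c" using b c by auto
    have "s' c = 0"
    proof (rule mu_independent[of "insert c T - {b}" s'])
      show "card (insert c T - {b}) \<le> 4" using T c b by (simp add: card_insert_if)
      show "(\<Sum>b\<in>insert c T - {b}. s' b * (b - 1)) = 0"
        using rel_s' b \<open>s b = 0\<close> s'_T[OF b] by (simp add: sum_diff1)
    qed (use T' s'K \<open>b \<noteq> c\<close> in auto)
    then show False by (simp add: s'_def)
  qed
  define s0 where "s0 = - (\<Sum>b\<in>insert c T. s' b)"
  have s0K: "s0 \<in> K" unfolding s0_def by (intro K_minus K_sum s'K)
  note rels_r = relation_from_difference_relation[OF T(1) r rel_r]
  note rels_s = relation_from_difference_relation[OF T' s'K rel_s', folded s0_def]
  \<comment> \<open>With this constant the factor \<open>b ^ q / b - \<zeta>\<close> vanishes at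
    \<open>c\<close>; with 1 in its place the factor vanishes at the base point.\<close>
  define \<zeta> where "\<zeta> = c ^ q / c"
  have T1: "1 \<notin> T" "1 \<notin> insert c T" using T c by auto
  let ?G = "\<lambda>\<alpha> \<beta> \<gamma> \<delta> b. \<alpha> + \<beta> * b + \<gamma> / b ^ q + \<delta> * b / b ^ q"
  have pair_r: "(\<Sum>b\<in>T. r b * (?G \<alpha> \<beta> \<gamma> \<delta> b * (b ^ q / b - 1))) = ?G \<alpha> \<beta> \<gamma> \<delta> 1 * (v ^ q - v)" for \<alpha> \<beta> \<gamma> \<delta>
  proof -
    have "(\<Sum>b\<in>insert 1 T. (r(1 := - sum r T)) b * (?G \<alpha> \<beta> \<gamma> \<delta> b * (b ^ q / b - 1)))
        = (\<Sum>b\<in>T. (r(1 := - sum r T)) b * (?G \<alpha> \<beta> \<gamma> \<delta> b * (b ^ q / b - 1)))"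
      using T1 fin by simp
    also have "\<dots> = (\<Sum>b\<in>T. r b * (?G \<alpha> \<beta> \<gamma> \<delta> b * (b ^ q / b - 1)))"
      using T1 by (intro sum.cong) auto
    finally show ?thesis
      using relation_product_bilinear_forms[OF rels_r(1,2) v rels_r(3,4), of \<alpha> \<beta> \<gamma> \<delta> 1] by simp
  qed
  have pair_s: "(\<Sum>b\<in>T. s b * (?G \<alpha> \<beta> \<gamma> \<delta> b * (b ^ q / b - \<zeta>))) + s0 * (?G \<alpha> \<beta> \<gamma> \<delta> 1 * (1 - \<zeta>)) = 0" for \<alpha> \<beta> \<gamma> \<delta>
  proof -
    have "(\<Sum>b\<in>insert 1 (insert c T). (s'(1 := s0)) b * (?G \<alpha> \<beta> \<gamma> \<delta> b * (b ^ q / b - \<zeta>)))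
        = s0 * (?G \<alpha> \<beta> \<gamma> \<delta> 1 * (1 - \<zeta>)) + (\<Sum>b\<in>T. (s'(1 := s0)) b * (?G \<alpha> \<beta> \<gamma> \<delta> b * (b ^ q / b - \<zeta>)))"
      using T1 c fin by (simp add: \<zeta>_def)
    also have "(\<Sum>b\<in>T. (s'(1 := s0)) b * (?G \<alpha> \<beta> \<gamma> \<delta> b * (b ^ q / b - \<zeta>)))
        = (\<Sum>b\<in>T. s b * (?G \<alpha> \<beta> \<gamma> \<delta> b * (b ^ q / b - \<zeta>)))"
      using T1 s'_T by (intro sum.cong) auto
    finally show ?thesis
      using relation_product_bilinear_forms[OF rels_s(1,2) V_0 rels_s(3,4), of \<alpha> \<beta> \<gamma> \<delta> \<zeta>] q_ge
      by (simp add: power_0_left add.commute)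
  qed
  \<comment> \<open>The multipliers of the two relations are chosen so that the terms with the value
    of the form at 1 cancel.\<close>
  define w where "w b = (v ^ q - v) * s b * (b ^ q / b - \<zeta>) + s0 * (1 - \<zeta>) * r b * (b ^ q / b - 1)" for b
  have pair_w: "(\<Sum>b\<in>T. w b * ?G \<alpha> \<beta> \<gamma> \<delta> b) = 0" for \<alpha> \<beta> \<gamma> \<delta>
  proof -
    have expand: "(x1 * x2 * x3 + y1 * y2 * y3) * g = x1 * (x2 * (g * x3)) + y1 * (y2 * (g * y3))"
      for x1 x2 x3 y1 y2 y3 g :: 'a
      by (simp add: algebra_simps)
    have "(\<Sum>b\<in>T. w b * ?G \<alpha> \<beta> \<gamma> \<delta> b) = (v ^ q - v) * (\<Sum>b\<in>T. s b * (?G \<alpha> \<beta> \<gamma> \<delta> b * (b ^ q / b - \<zeta>)))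
        + s0 * (1 - \<zeta>) * (\<Sum>b\<in>T. r b * (?G \<alpha> \<beta> \<gamma> \<delta> b * (b ^ q / b - 1)))"
      unfolding w_def sum_distrib_left sum.distrib[symmetric]
      by (intro sum.cong refl expand)
    also have "\<dots> = (v ^ q - v) * ((\<Sum>b\<in>T. s b * (?G \<alpha> \<beta> \<gamma> \<delta> b * (b ^ q / b - \<zeta>)))
        + s0 * (?G \<alpha> \<beta> \<gamma> \<delta> 1 * (1 - \<zeta>)))"
      unfolding pair_r by (simp only: distrib_left mult_ac)
    finally show ?thesis unfolding pair_s by simp
  qed
  have w0: "w b = 0" if b: "b \<in> T" for b
  proof -
    have "card (T - {b}) \<le> 3" using T b by simp
    then obtain \<alpha> \<beta> \<gamma> \<delta> where nz: "\<not> (\<alpha> = 0 \<and> \<beta> = 0 \<and> \<gamma> = 0 \<and> \<delta> = 0)"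
      and curve: "\<And>x. x \<in> T - {b} \<Longrightarrow> \<alpha> * x * x ^ q + \<beta> * x + \<gamma> * x ^ q + \<delta> = 0"
      using exists_bilinear_curve_through by blast
    \<comment> \<open>Multiplication by \<open>x ^ q\<close> turns the form into one of bidegree
      (1,1), with the coefficients permuted.\<close>
    have G: "?G \<gamma> \<alpha> \<delta> \<beta> x = (\<alpha> * x * x ^ q + \<beta> * x + \<gamma> * x ^ q + \<delta>) / x ^ q" if "x \<in> T" for x
    proof -
      have "x ^ q \<noteq> 0" using that T mu_nonzero by auto
      then show ?thesis by (simp add: field_simps)
    qed
    have "\<alpha> * b * b ^ q + \<beta> * b + \<gamma> * b ^ q + \<delta> \<noteq> 0"
      using mu_not_on_bilinear_curve[of T \<alpha> \<beta> \<gamma> \<delta>] T curve nz by blast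
    moreover have "b \<noteq> 0" using b T mu_nonzero by blast
    ultimately have Gb: "?G \<gamma> \<alpha> \<delta> \<beta> b \<noteq> 0" unfolding G[OF b] by simp
    have "w x * ?G \<gamma> \<alpha> \<delta> \<beta> x = 0" if "x \<in> T - {b}" for x
      using that curve[OF that] G[of x] by simp
    then have "(\<Sum>x\<in>T. w x * ?G \<gamma> \<alpha> \<delta> \<beta> x) = (\<Sum>x\<in>{b}. w x * ?G \<gamma> \<alpha> \<delta> \<beta> x)"
      using b fin by (intro sum.mono_neutral_right) auto
    then show ?thesis using pair_w Gb by simp
  qed
  define k where "k = (c - 1) / v"
  have k0: "k \<noteq> 0" using c v0 by (simp add: k_def)
  have bk: "b - c = k * (s0 * r b / s b) * (b - 1)" if b: "b \<in> T" for b
  proof -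
    have mu: "b \<in> mu" using b T by auto
    \<comment> \<open>The quantities \<open>b ^ q / b\<close>, \<open>\<zeta>\<close> and
      \<open>v ^ q - v\<close> are the \<open>q\<^sup>2\<close>-th powers of \<open>b\<close>,
      \<open>c\<close> and \<open>v\<close>, so \<open>w b = 0\<close> descends to a relation among
      \<open>b\<close>, \<open>c\<close> and \<open>v\<close>.\<close>
    have "(v * s b * (b - c) - s0 * (c - 1) * r b * (b - 1)) ^ (q ^ 2) = w b"
      using K_power[OF s[OF b], of 2] K_power[OF r[OF b], of 2] K_power[OF s0K, of 2]
      by (simp only: frobenius_diff power_mult_distrib mu_frobenius_2[OF mu] mu_frobenius_2[OF c(1)]
          V_frobenius_2[OF v] power_one w_def \<zeta>_def) (simp add: algebra_simps)
    then have "v * s b * (b - c) = s0 * (c - 1) * r b * (b - 1)"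
      using w0[OF b] by simp
    then show ?thesis using s_nz[OF b] v0 by (simp add: k_def field_simps)
  qed
  have "(k ^ q - k) * b * b ^ q + (k * c ^ q - k ^ q) * b + (k - k ^ q * c) * b ^ q + (k ^ q * c - k * c ^ q) = 0"
    if b: "b \<in> T" for b
  proof -
    \<comment> \<open>Being in the subfield, \<rho> can be eliminated between \<open>bk\<close> and
      its Frobenius image; what remains is a curve with coefficients independent of
      \<open>b\<close>.\<close>
    define \<rho> where "\<rho> = s0 * r b / s b"
    have "\<rho> ^ q = \<rho>" using s0K r[OF b] s[OF b] K_iff K_mult K_divide unfolding \<rho>_def by blast
    then have "(b - c) ^ q = k ^ q * \<rho> * (b - 1) ^ q"
      unfolding bk[OF b, folded \<rho>_def] by (simp add: power_mult_distrib)
    then have "k ^ q * (b - c) * (b - 1) ^ q - k * (b - c) ^ q * (b - 1) = 0"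
      using bk[OF b, folded \<rho>_def] by simp
    then show ?thesis by (simp only: frobenius_diff1 power_one) (simp add: algebra_simps)
  qed
  from mu_not_on_bilinear_curve[OF _ T(2) this] T
  have "k ^ q = k" "k * c ^ q = k ^ q" by auto
  then have "c ^ q = 1 ^ q" using k0 by simp
  then show False using c frobenius_inject1 by blast
qed

section \<open>Linear algebra over the subfield\<close>

text \<open>Every \<open>B\<close> is finite because the field is, so a combination over a subset
  extends by zero weights to all of \<open>B\<close>.\<close>

lemma in_span_iff: "x \<in> Fq_span q B \<longleftrightarrow> (\<exists>f. (\<forall>y\<in>B. f y \<in> K) \<and> x = (\<Sum>y\<in>B. f y * y :: 'a))"
proof
  assume "x \<in> Fq_span q B"
  then obtain T f where Tf: "T \<subseteq> B" "\<forall>y\<in>T. f y \<in> K" "x = (\<Sum>y\<in>T. f y * y)"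
    by (auto simp: Fq_span_def)
  have "x = (\<Sum>y\<in>B. (if y \<in> T then f y else 0) * y)"
    unfolding Tf(3) using Tf(1) by (intro sum.mono_neutral_cong_left) auto
  moreover have "\<forall>y\<in>B. (if y \<in> T then f y else 0) \<in> K" using Tf(2) by auto
  ultimately show "\<exists>f. (\<forall>y\<in>B. f y \<in> K) \<and> x = (\<Sum>y\<in>B. f y * y)"
    by (intro exI[of _ "\<lambda>y. if y \<in> T then f y else 0"]) simp
next
  assume "\<exists>f. (\<forall>y\<in>B. f y \<in> K) \<and> x = (\<Sum>y\<in>B. f y * y)"
  then obtain f where "\<forall>y\<in>B. f y \<in> K" "x = (\<Sum>y\<in>B. f y * y)" by blast
  then show "x \<in> Fq_span q B"
    unfolding Fq_span_def mem_Collect_eq by (intro exI[of _ B] exI[of _ f]) simp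
qed

lemma span_base: "x \<in> B \<Longrightarrow> (x::'a) \<in> Fq_span q B"
  unfolding in_span_iff
  by (rule exI[of _ "\<lambda>y. if y = x then 1 else 0"]) (simp add: if_distribR if_distrib[of "\<lambda>c. c * _"] cong: if_cong)

lemma span_add: "x \<in> Fq_span q B \<Longrightarrow> y \<in> Fq_span q B \<Longrightarrow> (x + y :: 'a) \<in> Fq_span q B"
proof -
  assume "x \<in> Fq_span q B" "y \<in> Fq_span q B"
  then obtain f g where "\<forall>z\<in>B. f z \<in> K" "x = (\<Sum>z\<in>B. f z * z)" "\<forall>z\<in>B. g z \<in> K" "y = (\<Sum>z\<in>B. g z * z)"
    by (auto simp: in_span_iff)
  then show ?thesis unfolding in_span_iff
    by (intro exI[of _ "\<lambda>z. f z + g z"]) (auto simp: distrib_right sum.distrib)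
qed

lemma span_scale: "c \<in> K \<Longrightarrow> x \<in> Fq_span q B \<Longrightarrow> (c * x :: 'a) \<in> Fq_span q B"
proof -
  assume "c \<in> K" "x \<in> Fq_span q B"
  then obtain f where "\<forall>z\<in>B. f z \<in> K" "x = (\<Sum>z\<in>B. f z * z)"
    by (auto simp: in_span_iff)
  with \<open>c \<in> K\<close> show ?thesis unfolding in_span_iff
    by (intro exI[of _ "\<lambda>z. c * f z"]) (auto simp: sum_distrib_left mult_ac)
qed

lemma span_diff: "x \<in> Fq_span q B \<Longrightarrow> y \<in> Fq_span q B \<Longrightarrow> (x - y :: 'a) \<in> Fq_span q B"
  using span_add[of x B "-1 * y"] span_scale[of "-1" y B] by simp

lemma span_0: "(0::'a) \<in> Fq_span q B"
  unfolding in_span_iff by (rule exI[of _ "\<lambda>_. 0"]) simp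

lemma span_sum: "(\<And>i. i \<in> I \<Longrightarrow> f i \<in> Fq_span q B) \<Longrightarrow> (\<Sum>i\<in>I. f i :: 'a) \<in> Fq_span q B"
  by (induction I rule: infinite_finite_induct) (auto simp: span_0 span_add)

lemma span_minimal: "B \<subseteq> Fq_span q C \<Longrightarrow> Fq_span q B \<subseteq> (Fq_span q C :: 'a set)"
proof
  fix x assume B: "B \<subseteq> Fq_span q C" and "x \<in> Fq_span q B"
  then obtain f where f: "\<forall>y\<in>B. f y \<in> K" "x = (\<Sum>y\<in>B. f y * y)" by (auto simp: in_span_iff)
  show "x \<in> Fq_span q C" unfolding f(2) using f(1) B by (intro span_sum span_scale) auto
qed

lemma indepI:
  assumes "\<And>f x. (\<And>y. y \<in> B \<Longrightarrow> f y \<in> K) \<Longrightarrow> (\<Sum>y\<in>B. f y * y) = 0 \<Longrightarrow> x \<in> B \<Longrightarrow> f x = (0::'a)"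
  shows "Fq_indep q B"
  unfolding Fq_indep_def
proof (intro allI impI ballI, elim conjE)
  fix T f x assume T: "T \<subseteq> B" "\<forall>x\<in>T. f x \<in> K" "(\<Sum>x\<in>T. f x * x) = 0" "x \<in> T"
  let ?g = "\<lambda>y. if y \<in> T then f y else 0"
  have "(\<Sum>y\<in>B. ?g y * y) = (\<Sum>y\<in>T. f y * y)"
    using T(1) by (intro sum.mono_neutral_cong_right) auto
  then have "?g x = 0" using assms[of ?g x] T by auto
  then show "f x = 0" using T by simp
qed

lemma indepD:
  assumes "Fq_indep q B" "\<And>y. y \<in> B \<Longrightarrow> f y \<in> K" "(\<Sum>y\<in>B. f y * y) = (0::'a)" "x \<in> B"
  shows "f x = 0"
proof -
  have "finite B \<and> B \<subseteq> B \<and> (\<forall>x\<in>B. f x \<in> K) \<and> (\<Sum>x\<in>B. f x * x) = 0" using assms by simp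
  then show ?thesis using assms(1,4) unfolding Fq_indep_def by blast
qed

lemma indep_mono: "Fq_indep q B \<Longrightarrow> C \<subseteq> B \<Longrightarrow> Fq_indep q (C :: 'a set)"
  unfolding Fq_indep_def by (blast dest: subset_trans)

lemma indep_insert:
  assumes "Fq_indep q B" "(x::'a) \<notin> Fq_span q B"
  shows "Fq_indep q (insert x B)"
proof (rule indepI)
  fix f y assume f: "\<And>y. y \<in> insert x B \<Longrightarrow> f y \<in> K" and sum: "(\<Sum>y\<in>insert x B. f y * y) = 0"
    and y: "y \<in> insert x B"
  have xB: "x \<notin> B" using assms(2) span_base by blast
  have sum': "f x * x + (\<Sum>y\<in>B. f y * y) = 0" using sum xB by simp
  have "f x = 0"
  proof (rule ccontr)
    assume "f x \<noteq> 0"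
    have "f x * x = - (\<Sum>y\<in>B. f y * y)" using sum' by (simp add: eq_neg_iff_add_eq_0)
    then have "x = (- 1 / f x) * (\<Sum>y\<in>B. f y * y)" using \<open>f x \<noteq> 0\<close> by (simp add: field_simps)
    also have "\<dots> \<in> Fq_span q B"
      using f by (intro span_scale span_sum span_base K_divide) auto
    finally show False using assms(2) by simp
  qed
  then show "f y = 0" using indepD[OF assms(1), of f y] sum' f y by auto
qed

lemma card_span_le: "card (Fq_span q B :: 'a set) \<le> q ^ card B"
proof -
  have "Fq_span q B \<subseteq> (\<lambda>f. \<Sum>y\<in>B. f y * y) ` (B \<rightarrow>\<^sub>E K)"
  proof
    fix x assume "x \<in> Fq_span q B"
    then obtain f where f: "\<forall>y\<in>B. f y \<in> K" "x = (\<Sum>y\<in>B. f y * y)" by (auto simp: in_span_iff)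
    then have "x = (\<Sum>y\<in>B. restrict f B y * y)" by (auto intro: sum.cong)
    moreover have "restrict f B \<in> B \<rightarrow>\<^sub>E K" using f by auto
    ultimately show "x \<in> (\<lambda>f. \<Sum>y\<in>B. f y * y) ` (B \<rightarrow>\<^sub>E K)" by blast
  qed
  then have "card (Fq_span q B) \<le> card ((\<lambda>f. \<Sum>y\<in>B. f y * y) ` (B \<rightarrow>\<^sub>E K))"
    by (intro card_mono) auto
  also have "\<dots> \<le> card (B \<rightarrow>\<^sub>E K)" by (intro card_image_le finite_PiE) auto
  finally show ?thesis by (simp add: card_PiE card_K)
qed

lemma card_span_indep:
  assumes "Fq_indep q (B :: 'a set)"
  shows "card (Fq_span q B) = q ^ card B"
proof -
  have "inj_on (\<lambda>f. \<Sum>y\<in>B. f y * y) (B \<rightarrow>\<^sub>E K)"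
  proof (rule inj_onI)
    fix f g assume fg: "f \<in> B \<rightarrow>\<^sub>E K" "g \<in> B \<rightarrow>\<^sub>E K" "(\<Sum>y\<in>B. f y * y) = (\<Sum>y\<in>B. g y * y)"
    have "(\<lambda>y. f y - g y) y = 0" if "y \<in> B" for y
    proof (rule indepD[OF assms _ _ that])
      show "f y - g y \<in> K" if "y \<in> B" for y
        using that PiE_mem[OF fg(1)] PiE_mem[OF fg(2)] by simp
      show "(\<Sum>y\<in>B. (f y - g y) * y) = 0"
        using fg(3) by (simp add: left_diff_distrib sum_subtractf)
    qed
    then show "f = g" using fg by (intro PiE_ext[of f B "\<lambda>_. K"]) auto
  qed
  then have "q ^ card B = card ((\<lambda>f. \<Sum>y\<in>B. f y * y) ` (B \<rightarrow>\<^sub>E K))"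
    by (simp add: card_image card_PiE card_K)
  also have "\<dots> \<le> card (Fq_span q B)"
  proof (intro card_mono image_subsetI)
    fix f assume "f \<in> B \<rightarrow>\<^sub>E K"
    then have "\<forall>y\<in>B. f y \<in> K" by (auto simp: PiE_mem)
    then show "(\<Sum>y\<in>B. f y * y) \<in> Fq_span q B" unfolding in_span_iff by blast
  qed simp
  finally show ?thesis using card_span_le[of B] by simp
qed

text \<open>Counting span elements takes the place of an exchange argument.\<close>

lemma card_indep_le:
  assumes "Fq_indep q (T :: 'a set)" "T \<subseteq> Fq_span q B"
  shows "card T \<le> card B"
proof -
  have "q ^ card T \<le> card (Fq_span q B)"
    using card_span_indep[OF assms(1)] span_minimal[OF assms(2)] by (metis card_mono finite)
  also have "\<dots> \<le> q ^ card B" by (rule card_span_le)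
  finally show ?thesis using q_ge by (simp add: power_increasing_iff)
qed

lemma in_pt_iff: "(x::'a) \<in> pt q y \<longleftrightarrow> (\<exists>c\<in>K. c \<noteq> 0 \<and> x = c * y)"
  unfolding pt_def mem_Collect_eq by metis

lemma in_pt_self: "(x::'a) \<in> pt q x"
  unfolding in_pt_iff by (rule bexI[of _ 1]) simp_all

lemma pt_eq_iff: "pt q (x::'a) = pt q y \<longleftrightarrow> (\<exists>c\<in>K. c \<noteq> 0 \<and> x = c * y)"
proof
  assume "pt q x = pt q y"
  then show "\<exists>c\<in>K. c \<noteq> 0 \<and> x = c * y" using in_pt_self[of x] by (simp add: in_pt_iff)
next
  assume "\<exists>c\<in>K. c \<noteq> 0 \<and> x = c * y"
  then obtain c where c: "c \<in> K" "c \<noteq> 0" "x = c * y" by blast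
  show "pt q x = pt q y"
  proof (intro set_eqI iffI)
    fix z assume "z \<in> pt q x"
    then obtain d where "d \<in> K" "d \<noteq> 0" "z = d * x" unfolding in_pt_iff by blast
    then show "z \<in> pt q y" unfolding in_pt_iff using c by (intro bexI[of _ "d * c"]) auto
  next
    fix z assume "z \<in> pt q y"
    then obtain d where "d \<in> K" "d \<noteq> 0" "z = d * y" unfolding in_pt_iff by blast
    then show "z \<in> pt q x" unfolding in_pt_iff using c by (intro bexI[of _ "d / c"]) auto
  qed
qed

lemma pt_in_PG_span_iff:
  assumes "(x::'a) \<noteq> 0"
  shows "pt q x \<in> PG q (Fq_span q B) \<longleftrightarrow> x \<in> Fq_span q B"
proof
  assume "pt q x \<in> PG q (Fq_span q B)"
  then obtain y where "y \<in> Fq_span q B" "pt q x = pt q y" by (auto simp: PG_def)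
  then show "x \<in> Fq_span q B" by (auto simp: pt_eq_iff intro: span_scale)
qed (use assms in \<open>auto simp: PG_def\<close>)

section \<open>Points of the projective space\<close>

lemma inj_minus_1: "inj_on (\<lambda>b::'a. b - 1) S"
  by (simp add: inj_on_def)

lemma indep_differences:
  assumes "S \<subseteq> mu - {1}" "card S \<le> 4"
  shows "Fq_indep q ((\<lambda>b. b - 1) ` S)"
proof (rule indepI)
  fix f x assume f: "\<And>y. y \<in> (\<lambda>b. b - 1) ` S \<Longrightarrow> f y \<in> K" and x: "x \<in> (\<lambda>b. b - 1) ` S"
    and sum: "(\<Sum>y\<in>(\<lambda>b. b - 1) ` S. f y * y) = 0"
  have "(\<Sum>b\<in>S. f (b - 1) * (b - 1)) = 0" using sum by (simp add: sum.reindex[OF inj_minus_1])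
  moreover obtain b where "b \<in> S" "x = b - 1" using x by blast
  ultimately show "f x = 0"
    using mu_independent[OF assms, of "\<lambda>b. f (b - 1)" b] f by simp
qed

text \<open>In a relation the differences sum to an element of \<open>V\<close>, so their weights
  vanish first and those of \<open>v1, v2\<close> afterwards.\<close>

lemma indep_differences_with_V:
  assumes S: "S \<subseteq> mu - {1}" "card S \<le> 3" and v: "v1 \<in> V" "v2 \<in> V"
    and v12: "Fq_indep q {v1, v2}"
  shows "Fq_indep q ((\<lambda>b. b - 1) ` S \<union> {v1, v2})"
proof (rule indepI)
  let ?D = "(\<lambda>b. b - 1) ` S"
  fix f x assume f: "\<And>y. y \<in> ?D \<union> {v1, v2} \<Longrightarrow> f y \<in> K" and x: "x \<in> ?D \<union> {v1, v2}"
    and sum: "(\<Sum>y\<in>?D \<union> {v1, v2}. f y * y) = 0"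
  have disj: "?D \<inter> {v1, v2} = {}" using S v mu_notin_V by auto
  have eq: "(\<Sum>y\<in>?D. f y * y) + (\<Sum>y\<in>{v1, v2}. f y * y) = 0"
    using sum by (simp only: sum.union_disjoint[OF finite finite disj])
  have "(\<Sum>y\<in>{v1, v2}. f y * y) \<in> V" using v f by (cases "v1 = v2") auto
  then have "(\<Sum>y\<in>?D. f y * y) \<in> V"
    using eq V_minus[of "\<Sum>y\<in>{v1, v2}. f y * y"] by (simp add: eq_neg_iff_add_eq_0[symmetric])
  then have "(\<Sum>b\<in>S. f (b - 1) * (b - 1)) \<in> V" by (simp add: sum.reindex[OF inj_minus_1])
  then have "f (b - 1) = 0" if "b \<in> S" for b
    using mu_independent_mod_V[OF S, of "\<lambda>b. f (b - 1)" b] f that by simp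
  then have fD: "f y = 0" if "y \<in> ?D" for y using that by blast
  then have "(\<Sum>y\<in>{v1, v2}. f y * y) = 0" using eq by simp
  then have "f y = 0" if "y \<in> {v1, v2}" for y
    using indepD[OF v12, of f y] f that by blast
  then show "f x = 0" using fD x by blast
qed

lemma mu_three_independent_mod_V:
  assumes "b1 \<in> mu - {1}" "b2 \<in> mu - {1}" "b3 \<in> mu - {1}" "b1 \<noteq> b2" "b1 \<noteq> b3" "b2 \<noteq> b3"
    and "c1 \<in> K" "c2 \<in> K" "c3 \<in> K"
    and "c1 * (b1 - 1) + c2 * (b2 - 1) + c3 * (b3 - 1) \<in> V"
  shows "c1 = 0"
proof -
  let ?f = "\<lambda>x. if x = b1 then c1 else if x = b2 then c2 else c3"
  have "(\<Sum>x\<in>{b1, b2, b3}. ?f x * (x - 1)) = c1 * (b1 - 1) + c2 * (b2 - 1) + c3 * (b3 - 1)"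
    using assms(4-6) by (simp add: add.assoc)
  then have "?f b1 = 0"
    using assms by (intro mu_independent_mod_V[of "{b1, b2, b3}" ?f]) (auto simp: card_insert_if add.assoc)
  then show ?thesis by simp
qed

text \<open>Modulo a hyperplane containing \<open>V\<close> the points of \<open>mu\<close> would form an arc of \<open>q\<^sup>2 - q\<close> points in a
  projective plane of order \<open>q\<close>, which is too large.\<close>

lemma exists_mu_outside_span:
  assumes S: "S \<subseteq> mu - {1}" "card S = 3" and v: "v1 \<in> V" "v2 \<in> V"
  shows "\<exists>b\<in>mu - {1}. b - 1 \<notin> Fq_span q ((\<lambda>b. b - 1) ` S \<union> {v1, v2})"
proof (rule ccontr)
  let ?H = "Fq_span q ((\<lambda>b. b - 1) ` S \<union> {v1, v2})"
  assume "\<not> ?thesis"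
  then have all: "b - 1 \<in> ?H" if "b \<in> mu - {1}" for b using that by blast
  obtain b1 b2 b3 where S_eq: "S = {b1, b2, b3}" and d: "b1 \<noteq> b2" "b2 \<noteq> b3" "b1 \<noteq> b3"
    using S(2) by (auto simp: card_3_iff)
  have mu: "b1 \<in> mu - {1}" "b2 \<in> mu - {1}" "b3 \<in> mu - {1}" using S S_eq by auto
  let ?M = "mu - {1, b1, b2}"
  have "\<exists>c1 c2 c3. c1 \<in> K \<and> c2 \<in> K \<and> c3 \<in> K \<and> b - 1 - (c1 * (b1 - 1) + c2 * (b2 - 1) + c3 * (b3 - 1)) \<in> V"
    if b: "b \<in> ?M" for b
  proof -
    obtain f where f: "\<forall>y\<in>(\<lambda>b. b - 1) ` S \<union> {v1, v2}. f y \<in> K"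
      "b - 1 = (\<Sum>y\<in>(\<lambda>b. b - 1) ` S \<union> {v1, v2}. f y * y)"
      using all[of b] b unfolding in_span_iff by blast
    have disj: "(\<lambda>b. b - 1) ` S \<inter> {v1, v2} = {}" using S v mu_notin_V by auto
    have "b - 1 - (\<Sum>y\<in>(\<lambda>b. b - 1) ` S. f y * y) = (\<Sum>y\<in>{v1, v2}. f y * y)"
      unfolding f(2) by (simp only: sum.union_disjoint[OF finite finite disj]) simp
    also have "\<dots> \<in> V" using v f(1) by (cases "v1 = v2") auto
    also have "(\<Sum>y\<in>(\<lambda>b. b - 1) ` S. f y * y) = f (b1 - 1) * (b1 - 1) + f (b2 - 1) * (b2 - 1) + f (b3 - 1) * (b3 - 1)"
      using d by (simp add: S_eq add.assoc)
    finally show ?thesis using f(1) S_eq by (intro exI[of _ "f (b1 - 1)"] exI[of _ "f (b2 - 1)"] exI[of _ "f (b3 - 1)"]) auto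
  qed
  then obtain c1 c2 c3 where c: "\<And>b. b \<in> ?M \<Longrightarrow> c1 b \<in> K" "\<And>b. b \<in> ?M \<Longrightarrow> c2 b \<in> K" "\<And>b. b \<in> ?M \<Longrightarrow> c3 b \<in> K"
    "\<And>b. b \<in> ?M \<Longrightarrow> b - 1 - (c1 b * (b1 - 1) + c2 b * (b2 - 1) + c3 b * (b3 - 1)) \<in> V"
    by metis
  have c3: "c3 b \<noteq> 0" if b: "b \<in> ?M" for b
  proof
    assume "c3 b = 0"
    then have "1 * (b - 1) + (- c1 b) * (b1 - 1) + (- c2 b) * (b2 - 1) \<in> V"
      using c(4)[OF b] by (simp add: algebra_simps)
    then have "(1::'a) = 0"
      using mu_three_independent_mod_V[of b b1 b2 1 "- c1 b" "- c2 b"] b mu d c(1-3)[OF b] by auto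
    then show False by simp
  qed
  \<comment> \<open>In the plane modulo \<open>V\<close> the ratio \<open>c2 b / c3 b\<close> names
    the line joining \<open>b\<close> to \<open>b1\<close>. Only \<open>q\<close> ratios are
    available for \<open>q\<^sup>2 - q - 2\<close> elements, so two of them are collinear with
    \<open>b1\<close>.\<close>
  have "card ((\<lambda>b. c2 b / c3 b) ` ?M) \<le> card K"
    using K_divide[OF c(2,3)] by (intro card_mono image_subsetI) simp_all
  also have "\<dots> < card ?M"
  proof -
    have "card {1, b1, b2} = 3" using mu d by auto
    then have "card ?M = card mu - 3" using mu by (subst card_Diff_subset) auto
    then show ?thesis using card_K card_mu q_square_ge q_ge by linarith
  qed
  finally have "\<not> inj_on (\<lambda>b. c2 b / c3 b) ?M" by (rule pigeonhole)
  then obtain b b' where b: "b \<in> ?M" "b' \<in> ?M" "b \<noteq> b'" "c2 b / c3 b = c2 b' / c3 b'"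
    unfolding inj_on_def by blast
  have "c3 b' * c2 b = c3 b * c2 b'" using b(4) c3[OF b(1)] c3[OF b(2)] by (simp add: field_simps)
  \<comment> \<open>This combination eliminates \<open>b3\<close>, and by the equal ratios also
    \<open>b2\<close>.\<close>
  have "c3 b' * (b - 1 - (c1 b * (b1 - 1) + c2 b * (b2 - 1) + c3 b * (b3 - 1)))
      - c3 b * (b' - 1 - (c1 b' * (b1 - 1) + c2 b' * (b2 - 1) + c3 b' * (b3 - 1))) \<in> V"
    by (rule V_diff[OF V_scale[OF c(3)[OF b(2)] c(4)[OF b(1)]] V_scale[OF c(3)[OF b(1)] c(4)[OF b(2)]]])
  also have "c3 b' * (b - 1 - (c1 b * (b1 - 1) + c2 b * (b2 - 1) + c3 b * (b3 - 1)))
      - c3 b * (b' - 1 - (c1 b' * (b1 - 1) + c2 b' * (b2 - 1) + c3 b' * (b3 - 1)))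
    = c3 b' * (b - 1) + (- c3 b) * (b' - 1) + (c3 b * c1 b' - c3 b' * c1 b) * (b1 - 1)
      + (c3 b * c2 b' - c3 b' * c2 b) * (b2 - 1)"
    by (simp add: algebra_simps)
  finally have "c3 b' * (b - 1) + (- c3 b) * (b' - 1) + (c3 b * c1 b' - c3 b' * c1 b) * (b1 - 1) \<in> V"
    using \<open>c3 b' * c2 b = c3 b * c2 b'\<close> by simp
  then have "c3 b' = 0"
    using mu_three_independent_mod_V[of b b' b1 "c3 b'" "- c3 b" "c3 b * c1 b' - c3 b' * c1 b"]
      b(1-3) mu c(1,3)[OF b(1)] c(1,3)[OF b(2)] by auto
  then show False using c3[OF b(2)] by simp
qed

lemma mu_inverse_distinct: "b \<in> mu - {1} \<Longrightarrow> inverse b \<in> mu - {1} \<and> inverse b \<noteq> b"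
proof -
  assume b: "b \<in> mu - {1}"
  then have "b * inverse b = 1" using mu_nonzero by simp
  then have "inverse b \<noteq> b" using mu_square[of b] b by auto
  then show ?thesis using b by simp
qed

text \<open>The elements \<open>b - 1/b\<close> are anti-invariant under \<open>x \<mapsto> x ^ (q ^ 3)\<close>, hence lie in a plane that
  contains the line of \<open>V\<close>. Only \<open>q\<close> further lines of this plane pass through \<open>v\<close>, so two distinct
  pairs \<open>{b, 1/b}\<close> share one of them.\<close>

lemma exists_four_mu_spanning_V_point:
  assumes v: "v \<in> V" "v \<noteq> 0"
  obtains S where "S \<subseteq> mu - {1}" "card S = 4" "v \<in> Fq_span q ((\<lambda>b. b - 1) ` S)"
proof -
  define F where "F x = x ^ q\<^sup>2 - x ^ q + x" for x :: 'a
  have F_V: "F x = 0 \<longleftrightarrow> x \<in> V" for x by (simp add: F_def Vker_def)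
  have F_diff: "F (x - y) = F x - F y" for x y
    by (simp add: F_def frobenius_diff frobenius_diff1)
  have F_scale: "F (c * x) = c * F x" if "c \<in> K" for c x
    using K_power[OF that, of 2] that by (simp add: F_def K_iff power_mult_distrib algebra_simps)
  define M where "M = mu - {1}"
  define a where "a b = b - inverse b" for b :: 'a
  have a_V: "a b \<notin> V" if b: "b \<in> M" for b
  proof
    assume "a b \<in> V"
    have ib: "inverse b \<in> mu - {1}" "inverse b \<noteq> b" using mu_inverse_distinct b by (auto simp: M_def)
    have "(\<Sum>x\<in>{b, inverse b}. (if x = b then 1 else -1) * (x - 1)) = a b"
      using ib by (simp add: a_def)
    then have "(if b = b then 1 else -1) = (0::'a)"
      using ib b \<open>a b \<in> V\<close>
      by (intro mu_independent_mod_V[of "{b, inverse b}" "\<lambda>x. if x = b then 1 else -1"])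
         (auto simp: M_def card_insert_if)
    then show False by simp
  qed
  have Fa_q: "F (a b) ^ q = - F (a b)" if b: "b \<in> M" for b
  proof -
    have mu: "b \<in> mu" "inverse b \<in> mu" using b by (auto simp: M_def)
    have "a b ^ (q ^ 3) = - a b"
      using mu_frobenius_3[OF mu(1)] mu_frobenius_3[OF mu(2)]
      by (simp add: a_def frobenius_diff divide_inverse)
    then show ?thesis
      by (simp add: F_def frobenius_add1 frobenius_diff1 flip: frobenius_3 frobenius_2)
  qed
  have Fa_0: "F (a b) \<noteq> 0" if "b \<in> M" for b using a_V[OF that] F_V by simp
  have card_M: "card M = q\<^sup>2 - q" using card_mu by (simp add: M_def)
  then have "M \<noteq> {}" using q_square_ge q_ge by auto
  then obtain b0 where b0: "b0 \<in> M" by blast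
  \<comment> \<open>The Frobenius map negates every \<open>F (a b)\<close>, so their quotients lie
    in the subfield. Scaling by \<open>\<kappa> b\<close> makes \<open>F (e b)\<close> independent
    of \<open>b\<close>, and the differences of the \<open>e b\<close> fall into
    \<open>V\<close>.\<close>
  define \<kappa> where "\<kappa> b = F (a b0) / F (a b)" for b
  have \<kappa>: "\<kappa> b \<in> K" "\<kappa> b \<noteq> 0" if "b \<in> M" for b
    using Fa_q[OF that] Fa_q[OF b0] Fa_0[OF that] Fa_0[OF b0] by (simp_all add: \<kappa>_def K_iff power_divide)
  define e where "e b = \<kappa> b * a b" for b
  have e_V: "e b - e b' \<in> V" if "b \<in> M" "b' \<in> M" for b b'
  proof -
    have "F (e b - e b') = 0"
      using that \<kappa>(1)[OF that(1)] \<kappa>(1)[OF that(2)] Fa_0[OF that(1)] Fa_0[OF that(2)]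
      by (simp add: F_diff e_def F_scale) (simp add: \<kappa>_def)
    then show ?thesis using F_V by blast
  qed
  \<comment> \<open>On \<open>V\<close> the expression \<open>u * v ^ q - u ^ q * v\<close> is
    additive in \<open>u\<close>, has values in the subfield and vanishes exactly on the subfield
    multiples of \<open>v\<close>.\<close>
  define \<phi> where "\<phi> b = (e b - e b0) * v ^ q - (e b - e b0) ^ q * v" for b
  have \<phi>_K: "\<phi> b \<in> K" if "b \<in> M" for b
  proof -
    define u where "u = e b - e b0"
    have "(u * v ^ q - u ^ q * v) ^ q = u ^ q * v ^ q\<^sup>2 - u ^ q\<^sup>2 * v ^ q"
      by (simp only: frobenius_diff1 power_mult_distrib frobenius_2)
    also have "\<dots> = u * v ^ q - u ^ q * v"
      by (simp only: V_frobenius_2[OF v(1)] V_frobenius_2[OF e_V[OF that b0], folded u_def]) (simp add: algebra_simps)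
    finally show ?thesis by (simp add: K_iff \<phi>_def u_def)
  qed
  \<comment> \<open>Some fibre has at least \<open>q - 1\<close> elements, hence at least three, and
    is not exhausted by \<open>b\<close> and \<open>inverse b\<close>.\<close>
  have "\<exists>y\<in>K. card (\<phi> -` {y} \<inter> M) * card K \<ge> card M"
    using \<phi>_K K_0 by (intro pigeonhole_card) (simp, simp, simp, blast)
  then obtain y where y: "card (\<phi> -` {y} \<inter> M) * q \<ge> q\<^sup>2 - q" using card_K card_M by auto
  have "card (\<phi> -` {y} \<inter> M) > 2"
  proof (rule ccontr)
    assume "\<not> ?thesis"
    then have "card (\<phi> -` {y} \<inter> M) * q \<le> 2 * q" by (intro mult_right_mono) auto
    then show False using y q_square_ge q_ge by linarith
  qed
  then obtain b where b: "b \<in> M" "\<phi> b = y"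
    by (metis (no_types, lifting) Int_iff card.empty equals0I less_nat_zero_code vimage_singleton_eq)
  have "\<exists>b'. b' \<in> (\<phi> -` {y} \<inter> M) - {b, inverse b}"
  proof (rule ccontr)
    assume "\<not> ?thesis"
    then have "\<phi> -` {y} \<inter> M \<subseteq> {b, inverse b}" by blast
    then have "card (\<phi> -` {y} \<inter> M) \<le> card {b, inverse b}" by (intro card_mono) auto
    also have "\<dots> \<le> 2" by (simp add: card_insert_if)
    finally show False using \<open>card (\<phi> -` {y} \<inter> M) > 2\<close> by simp
  qed
  then obtain b' where b': "b' \<in> M" "\<phi> b' = y" "b' \<noteq> b" "b' \<noteq> inverse b" by blast
  define S where "S = {b, inverse b, b', inverse b'}"
  have ib: "inverse b \<in> mu - {1}" "inverse b \<noteq> b" "inverse b' \<in> mu - {1}" "inverse b' \<noteq> b'"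
    using mu_inverse_distinct b b' by (auto simp: M_def)
  have d: "inverse b' \<noteq> b" "inverse b' \<noteq> inverse b" using b' by auto
  have S: "S \<subseteq> mu - {1}" using ib b b' by (auto simp: S_def M_def)
  have card_S: "card S = 4" using ib b' d by (simp add: S_def)
  define w where "w = e b - e b'"
  have "w * v ^ q - w ^ q * v = \<phi> b - \<phi> b'"
    by (simp add: w_def \<phi>_def frobenius_diff1 algebra_simps)
  then have "(w / v) ^ q = w / v"
    using b b' v(2) by (simp add: power_divide field_simps)
  then have wv: "w / v \<in> K" by (simp add: K_iff)
  have "w \<noteq> 0"
  proof
    assume "w = 0"
    \<comment> \<open>The weights of \<open>w\<close> as a combination of the four differences; as
      \<open>\<kappa> b\<close> is nonzero, \<open>w = 0\<close> would contradict
      independence.\<close>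
    define f where "f x = (if x = b then \<kappa> b else if x = inverse b then - \<kappa> b else if x = b' then - \<kappa> b' else \<kappa> b')" for x
    have "(\<Sum>x\<in>S. f x * (x - 1)) = w"
      unfolding S_def w_def e_def a_def
      using ib b' d by (simp add: f_def algebra_simps)
    moreover have "f x \<in> K" for x
      using \<kappa>(1)[OF b(1)] \<kappa>(1)[OF b'(1)] by (simp add: f_def)
    ultimately have "f b = 0"
      using card_S \<open>w = 0\<close> mu_independent[OF S, of f b] by (simp add: S_def)
    then show False using \<kappa>(2)[OF b(1)] by (simp add: f_def)
  qed
  have base: "x - 1 \<in> Fq_span q ((\<lambda>b. b - 1) ` S)" if "x \<in> S" for x
    using that by (intro span_base) auto
  have "\<kappa> b * ((b - 1) - (inverse b - 1)) - \<kappa> b' * ((b' - 1) - (inverse b' - 1)) \<in> Fq_span q ((\<lambda>b. b - 1) ` S)"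
    by (rule span_diff[OF span_scale[OF \<kappa>(1)[OF b(1)] span_diff[OF base base]]
          span_scale[OF \<kappa>(1)[OF b'(1)] span_diff[OF base base]]]) (auto simp: S_def)
  then have "w \<in> Fq_span q ((\<lambda>b. b - 1) ` S)" by (simp add: w_def e_def a_def)
  then have "(1 / (w / v)) * w \<in> Fq_span q ((\<lambda>b. b - 1) ` S)"
    using wv by (intro span_scale[OF K_divide[OF K_1]])
  then have "v \<in> Fq_span q ((\<lambda>b. b - 1) ` S)" using \<open>w \<noteq> 0\<close> by simp
  then show ?thesis using that S card_S by blast
qed

section \<open>The set of \<open>q\<^sup>2 - q + 2\<close> points\<close>

context
  fixes v1 v2 :: 'a
  assumes v1: "v1 \<in> V" and v2: "v2 \<in> V" and v12: "Fq_indep q {v1, v2}" and v1_neq_v2: "v1 \<noteq> v2"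
begin

definition reps :: "'a set" where
  "reps = (\<lambda>b. b - 1) ` (mu - {1}) \<union> {v1, v2}"

text \<open>If \<open>T\<close> contains \<open>v1\<close> or \<open>v2\<close>, at most three
  differences remain, and these are independent together with both; otherwise \<open>T\<close>
  consists of at most four differences.\<close>

lemma indep_reps:
  assumes "T \<subseteq> reps" "card T \<le> 4"
  shows "Fq_indep q T"
proof -
  define S where "S = {b \<in> mu - {1}. b - 1 \<in> T}"
  have S: "S \<subseteq> mu - {1}" and ST: "(\<lambda>b. b - 1) ` S \<subseteq> T" by (auto simp: S_def)
  have T_sub: "T \<subseteq> (\<lambda>b. b - 1) ` S \<union> {v1, v2}" using assms(1) by (auto simp: S_def reps_def)
  have card_S: "card S = card ((\<lambda>b. b - 1) ` S)" by (simp add: card_image inj_minus_1)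
  show ?thesis
  proof (cases "v1 \<in> T \<or> v2 \<in> T")
    case True
    have "v \<notin> (\<lambda>b. b - 1) ` S" if "v \<in> V" for v using S mu_notin_V that by auto
    then have "(\<lambda>b. b - 1) ` S \<noteq> T" using True v1 v2 by blast
    then have "card S < card T" unfolding card_S using ST by (intro psubset_card_mono) auto
    then have "Fq_indep q ((\<lambda>b. b - 1) ` S \<union> {v1, v2})"
      using assms(2) by (intro indep_differences_with_V S v1 v2 v12) simp
    then show ?thesis using T_sub indep_mono by blast
  next
    case False
    then have "(\<lambda>b. b - 1) ` S = T" using T_sub ST by blast
    then show ?thesis using indep_differences[OF S] card_S assms(2) by simp
  qed
qed

lemma reps_nonzero: "x \<in> reps \<Longrightarrow> x \<noteq> 0"
proof
  assume x: "x \<in> reps" "x = 0"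
  have "Fq_indep q {x}" using x(1) by (intro indep_reps) auto
  from indepD[OF this, of "\<lambda>_. 1" x] show False using x(2) by simp
qed

lemma inj_on_pt_reps: "inj_on (pt q) reps"
proof (rule inj_onI, rule ccontr)
  fix x y assume xy: "x \<in> reps" "y \<in> reps" "pt q x = pt q y" "x \<noteq> y"
  then obtain c where c: "c \<in> K" "x = c * y" by (auto simp: pt_eq_iff)
  have "Fq_indep q {x, y}" using xy(1,2) by (intro indep_reps) (auto simp: card_insert_if)
  moreover have "(if z = x then 1 else - c) \<in> K" for z using c by simp
  moreover have "(\<Sum>z\<in>{x, y}. (if z = x then 1 else - c) * z) = 0" using c xy(4) by simp
  ultimately show False using indepD[of "{x, y}" "\<lambda>z. if z = x then 1 else - c" x] by simp
qed

lemma card_reps: "card reps = q\<^sup>2 - q + 2"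
proof -
  have "(\<lambda>b. b - 1) ` (mu - {1}) \<inter> {v1, v2} = {}" using mu_notin_V v1 v2 by auto
  then have "card reps = card ((\<lambda>b::'a. b - 1) ` (mu - {1})) + card {v1, v2}"
    unfolding reps_def by (intro card_Un_disjoint) auto
  also have "card ((\<lambda>b::'a. b - 1) ` (mu - {1})) = card (mu - {1})"
    by (rule card_image[OF inj_minus_1])
  finally show ?thesis using v1_neq_v2 card_mu by simp
qed

lemma card_plane_Int_reps:
  assumes "proj_subspace q 2 S"
  shows "card (S \<inter> pt q ` reps) \<le> 3"
proof -
  obtain B where B: "card B = 3" "S = PG q (Fq_span q B)"
    using assms by (auto simp: proj_subspace_def)
  let ?T = "reps \<inter> Fq_span q B"
  have "card ?T \<le> 3"
  proof (rule ccontr)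
    assume "\<not> card ?T \<le> 3"
    then obtain T where T: "T \<subseteq> ?T" "card T = 4"
      using obtain_subset_with_card_n[of 4 ?T] by auto
    then have "card T \<le> card B" by (intro card_indep_le indep_reps) auto
    then show False using T B by simp
  qed
  moreover have "S \<inter> pt q ` reps = pt q ` ?T"
    using B reps_nonzero by (auto simp: pt_in_PG_span_iff)
  ultimately show ?thesis using card_image_le[of ?T "pt q"] by simp
qed

text \<open>Three differences, \<open>v1\<close>, \<open>v2\<close> and a difference outside their
  span are six independent vectors, whose span has \<open>q ^ 6\<close> elements.\<close>

lemma span_reps: "Fq_span q reps = UNIV"
proof -
  have "3 \<le> card (mu - {1})" using card_mu q_square_ge q_ge by simp
  then obtain S where S: "S \<subseteq> mu - {1}" "card S = 3" by (meson obtain_subset_with_card_n)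
  obtain b where b: "b \<in> mu - {1}" "b - 1 \<notin> Fq_span q ((\<lambda>b. b - 1) ` S \<union> {v1, v2})"
    using exists_mu_outside_span[OF S v1 v2] by blast
  let ?B = "(\<lambda>b. b - 1) ` S \<union> {v1, v2}"
  have "(\<lambda>b. b - 1) ` S \<inter> {v1, v2} = {}" using mu_notin_V v1 v2 S by auto
  then have "card ?B = 5"
    using S v1_neq_v2 by (subst card_Un_disjoint) (auto simp: card_image inj_minus_1)
  moreover have "b - 1 \<notin> ?B" using b(2) span_base[of "b - 1" ?B] by blast
  ultimately have "card (insert (b - 1) ?B) = 6" by simp
  moreover have "Fq_indep q (insert (b - 1) ?B)"
    using S by (intro indep_insert indep_differences_with_V v1 v2 v12 b(2)) auto
  ultimately have "card (Fq_span q (insert (b - 1) ?B)) = card (UNIV :: 'a set)"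
    using card_span_indep card_UNIV by metis
  then have "Fq_span q (insert (b - 1) ?B) = UNIV" by (intro card_subset_eq) auto
  moreover have "insert (b - 1) ?B \<subseteq> Fq_span q reps"
    using b(1) S(1) by (intro subsetI span_base) (auto simp: reps_def)
  ultimately show ?thesis using span_minimal by blast
qed

text \<open>The solid is spanned by four differences whose span contains \<open>v1\<close>; all
  further representatives have to be excluded.\<close>

lemma exists_solid_with_five_reps:
  "\<exists>S. proj_subspace q 3 S \<and> card (S \<inter> pt q ` reps) = 5"
proof -
  have "v1 \<noteq> 0" using reps_nonzero by (simp add: reps_def)
  then obtain T where T: "T \<subseteq> mu - {1}" "card T = 4" and v1T: "v1 \<in> Fq_span q ((\<lambda>b. b - 1) ` T)"
    using exists_four_mu_spanning_V_point[OF v1] by blast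
  let ?B = "(\<lambda>b. b - 1) ` T"
  have card_B: "card ?B = 4" using T by (simp add: card_image inj_minus_1)
  have indep_B: "Fq_indep q ?B" using T by (intro indep_differences) auto
  have coeffs: "\<exists>r. (\<forall>b\<in>T. r b \<in> K) \<and> (\<Sum>b\<in>T. r b * (b - 1)) = x"
    if xB: "x \<in> Fq_span q ?B" for x
  proof -
    obtain f where f: "\<forall>y\<in>?B. f y \<in> K" "x = (\<Sum>y\<in>?B. f y * y)" 
      using iffD1[OF in_span_iff xB] by blast
    then show ?thesis
      by (intro exI[of _ "\<lambda>b. f (b - 1)"]) (auto simp: sum.reindex[OF inj_minus_1])
  qed
  have "reps \<inter> Fq_span q ?B = insert v1 ?B"
  proof
    show "insert v1 ?B \<subseteq> reps \<inter> Fq_span q ?B"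
      using T v1T span_base by (auto simp: reps_def)
    show "reps \<inter> Fq_span q ?B \<subseteq> insert v1 ?B"
    proof
      fix x assume x: "x \<in> reps \<inter> Fq_span q ?B"
      then consider "x = v1" | "x = v2" | c where "c \<in> mu - {1}" "x = c - 1" by (auto simp: reps_def)
      then show "x \<in> insert v1 ?B"
      proof cases
        case 2
        \<comment> \<open>If \<open>v2\<close> were in the span as well, three differences with
          \<open>v1\<close> and \<open>v2\<close> would be five independent vectors in the span of
          four.\<close>
        obtain T3 where T3: "T3 \<subseteq> T" "card T3 = 3" using obtain_subset_with_card_n[of 3 T] T by auto
        let ?C = "(\<lambda>b. b - 1) ` T3 \<union> {v1, v2}"
        have "(\<lambda>b. b - 1) ` T3 \<inter> {v1, v2} = {}" using mu_notin_V v1 v2 T T3 by auto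
        then have "card ?C = 5"
          using T3 v1_neq_v2 by (subst card_Un_disjoint) (auto simp: card_image inj_minus_1)
        moreover have "card ?C \<le> card ?B"
        proof (rule card_indep_le)
          show "Fq_indep q ?C" using T T3 by (intro indep_differences_with_V v1 v2 v12) auto
          show "?C \<subseteq> Fq_span q ?B" using T3 2 x v1T span_base by auto
        qed
        ultimately show ?thesis using card_B by simp
      next
        case 3
        obtain r where r: "\<forall>b\<in>T. r b \<in> K" "(\<Sum>b\<in>T. r b * (b - 1)) = v1" using coeffs[OF v1T] by blast
        obtain s where s: "\<forall>b\<in>T. s b \<in> K" "(\<Sum>b\<in>T. s b * (b - 1)) = c - 1" using coeffs[of x] x 3 by blast
        \<comment> \<open>For any other \<open>c\<close>, the span would contain both
          \<open>c - 1\<close> and the nonzero \<open>v1\<close>, which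
          \<open>mu_notin_tangent_span\<close> forbids.\<close>
        have "c \<in> T"
        proof (rule ccontr)
          assume "c \<notin> T"
          then have "v1 = 0"
            using mu_notin_tangent_span[OF T, of c r s v1] 3 r s v1 by blast
          then show False using \<open>v1 \<noteq> 0\<close> by simp
        qed
        then show ?thesis using 3 by blast
      qed simp
    qed
  qed
  moreover have "PG q (Fq_span q ?B) \<inter> pt q ` reps = pt q ` (reps \<inter> Fq_span q ?B)"
    using reps_nonzero by (auto simp: pt_in_PG_span_iff)
  moreover have "card (pt q ` (reps \<inter> Fq_span q ?B)) = card (reps \<inter> Fq_span q ?B)"
    by (intro card_image inj_on_subset[OF inj_on_pt_reps]) auto
  moreover have "v1 \<notin> ?B" using mu_notin_V v1 T by auto
  ultimately have "card (PG q (Fq_span q ?B) \<inter> pt q ` reps) = 5" using card_B by simp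
  moreover have "proj_subspace q 3 (PG q (Fq_span q ?B))"
    unfolding proj_subspace_def using card_B indep_B by (intro exI[of _ ?B]) simp
  ultimately show ?thesis by blast
qed

lemma four_general_reps: "four_general q (pt q ` reps)"
  unfolding four_general_def rs_set_def
proof (intro conjI ballI allI impI)
  show "is_point q P" if "P \<in> pt q ` reps" for P
    using that reps_nonzero by (auto simp: is_point_def)
  show "card (S \<inter> pt q ` reps) \<le> 3" if "proj_subspace q 2 S" for S
    using that by (rule card_plane_Int_reps)
  have "reps \<subseteq> Fq_span q (\<Union> (pt q ` reps))"
    using in_pt_self by (intro subsetI span_base) blast
  then show "Fq_span q (\<Union> (pt q ` reps)) = UNIV"
    using span_minimal span_reps by blast
  show "\<exists>S. proj_subspace q (2 + 1) S \<and> card (S \<inter> pt q ` reps) = 3 + 2"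
    using exists_solid_with_five_reps by simp
qed

lemma pt_reps_eq: "pt q ` reps = Yset q \<union> {pt q v1, pt q v2}"
  by (auto simp: reps_def Yset_def mu_def)

end

end

theorem mainTheorem17:
  fixes q :: nat and P1 P2 :: "'a::{field, finite} set"
  assumes "prime_power q" and "q \<ge> 4" and "card (UNIV :: 'a set) = q ^ 6"
    and "P1 \<in> PG q (Vker q)" and "P2 \<in> PG q (Vker q)" and "P1 \<noteq> P2"
  shows "four_general q (Yset q \<union> {P1, P2}) \<and> card (Yset q \<union> {P1, P2}) = q\<^sup>2 - q + 2"
proof -
  interpret sextic_field q "TYPE('a)" by unfold_locales fact+
  obtain v1 v2 where v: "v1 \<in> Vker q" "v1 \<noteq> 0" "P1 = pt q v1" "v2 \<in> Vker q" "v2 \<noteq> 0" "P2 = pt q v2"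
    using assms(4,5) by (auto simp: PG_def)
  have "v1 \<noteq> v2" using v assms(6) by auto
  \<comment> \<open>Proportional vectors give the same point, so distinct points have independent
    representatives.\<close>
  have "v1 \<notin> Fq_span q {v2}"
  proof
    assume "v1 \<in> Fq_span q {v2}"
    then obtain f where "f v2 \<in> Fq q" "v1 = f v2 * v2" by (auto simp: in_span_iff)
    then have "pt q v1 = pt q v2" unfolding pt_eq_iff using v(2) by (intro bexI[of _ "f v2"]) auto
    then show False using v assms(6) by simp
  qed
  moreover have "Fq_indep q {v2}" using v(5) by (intro indepI) auto
  ultimately have "Fq_indep q {v1, v2}" by (intro indep_insert[of "{v2}"])
  note four_general_reps[OF v(1,4) this \<open>v1 \<noteq> v2\<close>] pt_reps_eq[OF v(1,4) this \<open>v1 \<noteq> v2\<close>]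
    card_image[OF inj_on_pt_reps[OF v(1,4) this \<open>v1 \<noteq> v2\<close>]] card_reps[OF v(1,4) this \<open>v1 \<noteq> v2\<close>]
  then show ?thesis using v(3,6) by simp
qed

end
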